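(* Let $m\in H^\infty$ be inner, $H=H^2\ominus mH^2$ with $\dim H\ge2$, and $T=P_HS|_H$. Then $T^2$ is reducible if and only if either $m(\lambda)=m(-\lambda)$ for all $\lambda\in\mathbb D$, or there exists $\mu\in\mathbb D$ such that $$m(\lambda)=p(\lambda)\,\frac{\lambda+\mu}{1+\bar\mu\lambda}\quad(\lambda\in\mathbb D)$$ for some function $p\in H^\infty$ satisfying $p(\lambda)=p(-\lambda)$ for all $\lambda\in\mathbb D$.
   Context: $S$ is the unilateral shift $(Sh)(z)=zh(z)$ on the Hardy space $H^2$ of the unit disc $\mathbb D$; $P_H$ is the orthogonal projection onto $H$. Reducible means having a nontrivial (neither $\{0\}$ nor the whole space) closed subspace invariant under the operator and its adjoint. *)

theory Defs
  imports "HOL-Analysis.Analysis"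
begin

text \<open>The Hardy space H^2 of the unit disc, realised as functions complex => complex that
  are holomorphic on the open unit disc, vanish outside it (a normalisation so that equality
  of elements is plain function equality), and have square-summable Taylor coefficients at 0.\<close>

definition h2_coeff :: "(complex \<Rightarrow> complex) \<Rightarrow> nat \<Rightarrow> complex" where
  "h2_coeff f n = (deriv ^^ n) f 0 / of_nat (fact n)"

definition H2 :: "(complex \<Rightarrow> complex) set" where
  "H2 = {f. f holomorphic_on ball 0 1 \<and> (\<forall>z. z \<notin> ball 0 1 \<longrightarrow> f z = 0)
            \<and> summable (\<lambda>n. (norm (h2_coeff f n))\<^sup>2)}"

definition h2_inner :: "(complex \<Rightarrow> complex) \<Rightarrow> (complex \<Rightarrow> complex) \<Rightarrow> complex" where
  "h2_inner f g = (\<Sum>n. h2_coeff f n * cnj (h2_coeff g n))"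

definition h2_norm :: "(complex \<Rightarrow> complex) \<Rightarrow> real" where
  "h2_norm f = sqrt (\<Sum>n. (norm (h2_coeff f n))\<^sup>2)"

text \<open>H^infinity: bounded holomorphic functions on the disc (values outside irrelevant).\<close>
definition Hinf :: "(complex \<Rightarrow> complex) set" where
  "Hinf = {f. f holomorphic_on ball 0 1 \<and> (\<exists>B. \<forall>z\<in>ball 0 1. norm (f z) \<le> B)}"

definition inner_function :: "(complex \<Rightarrow> complex) \<Rightarrow> bool" where
  "inner_function m \<longleftrightarrow> m \<in> Hinf \<and>
     (AE t in lborel. t \<in> {0..2*pi} \<longrightarrow>
        (\<exists>l. ((\<lambda>r. m (complex_of_real r * cis t)) \<longlongrightarrow> l) (at_left 1) \<and> norm l = 1))"

definition model_space :: "(complex \<Rightarrow> complex) \<Rightarrow> (complex \<Rightarrow> complex) set" where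
  "model_space m = {f \<in> H2. \<forall>g\<in>H2. h2_inner f (\<lambda>z. m z * g z) = 0}"

definition proj :: "(complex \<Rightarrow> complex) set \<Rightarrow> (complex \<Rightarrow> complex) \<Rightarrow> (complex \<Rightarrow> complex)" where
  "proj K f = (THE g. g \<in> K \<and> (\<forall>k\<in>K. h2_inner (\<lambda>z. f z - g z) k = 0))"

definition shift :: "(complex \<Rightarrow> complex) \<Rightarrow> (complex \<Rightarrow> complex)" where
  "shift h = (\<lambda>z. z * h z)"

definition compressed_shift :: "(complex \<Rightarrow> complex) \<Rightarrow> (complex \<Rightarrow> complex) \<Rightarrow> (complex \<Rightarrow> complex)" where
  "compressed_shift m h = proj (model_space m) (shift h)"

definition op_adjoint :: "(complex \<Rightarrow> complex) set \<Rightarrow> ((complex \<Rightarrow> complex) \<Rightarrow> (complex \<Rightarrow> complex))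
    \<Rightarrow> (complex \<Rightarrow> complex) \<Rightarrow> (complex \<Rightarrow> complex)" where
  "op_adjoint K A y = (THE z. z \<in> K \<and> (\<forall>x\<in>K. h2_inner (A x) y = h2_inner x z))"

definition lin_subspace :: "(complex \<Rightarrow> complex) set \<Rightarrow> bool" where
  "lin_subspace M \<longleftrightarrow> (\<lambda>z. 0) \<in> M \<and> (\<forall>f\<in>M. \<forall>g\<in>M. (\<lambda>z. f z + g z) \<in> M)
     \<and> (\<forall>c. \<forall>f\<in>M. (\<lambda>z. c * f z) \<in> M)"

definition h2_closed :: "(complex \<Rightarrow> complex) set \<Rightarrow> bool" where
  "h2_closed M \<longleftrightarrow> M \<subseteq> H2 \<and> (\<forall>s f. (\<forall>n. s n \<in> M) \<and> f \<in> H2 \<and>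
       (\<lambda>n. h2_norm (\<lambda>z. s n z - f z)) \<longlonglongrightarrow> 0 \<longrightarrow> f \<in> M)"

definition reducible_on :: "(complex \<Rightarrow> complex) set \<Rightarrow> ((complex \<Rightarrow> complex) \<Rightarrow> (complex \<Rightarrow> complex)) \<Rightarrow> bool" where
  "reducible_on K A \<longleftrightarrow> (\<exists>M. M \<subseteq> K \<and> lin_subspace M \<and> h2_closed M \<and>
      M \<noteq> {\<lambda>z. 0} \<and> M \<noteq> K \<and> (\<forall>x\<in>M. A x \<in> M) \<and> (\<forall>x\<in>M. op_adjoint K A x \<in> M))"

definition dim_ge2 :: "(complex \<Rightarrow> complex) set \<Rightarrow> bool" where
  "dim_ge2 K \<longleftrightarrow> (\<exists>f\<in>K. \<exists>g\<in>K. \<forall>a b::complex.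
      (\<lambda>z. a * f z + b * g z) = (\<lambda>z. 0) \<longrightarrow> a = 0 \<and> b = 0)"

end

theory Submission
  imports Defs "HOL-Complex_Analysis.Complex_Analysis" "HOL-Real_Asymp.Real_Asymp"
begin

text \<open>
  Taylor coefficients identify \<open>H\<^sup>2\<close> with the square-summable formal power series, where
  multiplication by the inner function \<open>m\<close> is an isometry. For a unit vector \<open>(a, b)\<close> let \<open>P\<close> be the
  projection onto \<open>(a + b z) H\<^sup>2(z\<^sup>2)\<close>; its complement is \<open>(- cnj b + cnj a z) H\<^sup>2(z\<^sup>2)\<close>.

  If \<open>N\<close> reduces \<open>T\<^sup>2\<close>, then the pairs formed by the first two coefficients of elements of \<open>N\<close> span
  a line (two independent pairs would force \<open>N = H\<close>, as \<open>1 - T\<^sup>2 T\<^sup>2\<^sup>*\<close> maps \<open>N\<close> into itself and only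
  sees those coefficients). For \<open>(a, b)\<close> on that line, \<open>P\<close> leaves \<open>m H\<^sup>2\<close> invariant; conversely such a
  \<open>P\<close> cuts out a reducing subspace. Pulling \<open>P\<close> back along the isometry \<open>m\<close> gives a projection
  commuting with \<open>z\<^sup>2\<close>, hence of the same form with some unit vector \<open>(a', b')\<close>, so that
  \<open>m (a' + b' z) = (a + b z) u\<close> and \<open>m (- cnj b' + cnj a' z) = (- cnj b + cnj a z) v\<close> with even \<open>u, v\<close>.
  Eliminating \<open>m(z)\<close> and \<open>m(-z)\<close> yields \<open>a cnj b = a' cnj b'\<close>, which leaves two cases: \<open>(a', b')\<close> is
  proportional to \<open>(a, b)\<close> and \<open>m\<close> is even, or it is proportional to \<open>(cnj b, cnj a)\<close> and \<open>m\<close> is an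
  even function times a Blaschke factor.
\<close>

section \<open>Square-summable power series\<close>

text \<open>Formal power series stand in for functions: products are Cauchy products, and nonzero
  factors cancel because the ring is an integral domain.\<close>

definition l2 :: "complex fps set" where
  "l2 = {F. summable (\<lambda>n. (cmod (fps_nth F n))\<^sup>2)}"

definition l2_inner :: "complex fps \<Rightarrow> complex fps \<Rightarrow> complex" where
  "l2_inner F G = (\<Sum>n. fps_nth F n * cnj (fps_nth G n))"

definition l2_normsq :: "complex fps \<Rightarrow> real" where
  "l2_normsq F = (\<Sum>n. (cmod (fps_nth F n))\<^sup>2)"

lemma l2D: "F \<in> l2 \<Longrightarrow> summable (\<lambda>n. (cmod (fps_nth F n))\<^sup>2)"
  by (simp add: l2_def)

lemma l2I:
  assumes "\<And>N. (\<Sum>n<N. (cmod (fps_nth F n))\<^sup>2) \<le> B"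
  shows "F \<in> l2"
proof -
  have "(\<Sum>n\<le>N. (cmod (fps_nth F n))\<^sup>2) \<le> B" for N
    using assms[of "Suc N"] unfolding lessThan_Suc_atMost .
  then show ?thesis
    unfolding l2_def by (intro CollectI bounded_imp_summable[where B = B]) auto
qed

lemma norm_add_sq_le: "(norm (x + y :: complex))\<^sup>2 \<le> 2 * (norm x)\<^sup>2 + 2 * (norm y)\<^sup>2"
proof -
  have "(norm (x + y))\<^sup>2 \<le> (norm x + norm y)\<^sup>2"
    by (intro power_mono norm_triangle_ineq) auto
  also have "\<dots> \<le> 2 * (norm x)\<^sup>2 + 2 * (norm y)\<^sup>2"
    using zero_le_power2[of "norm x - norm y"] by (simp add: power2_sum power2_diff)
  finally show ?thesis .
qed

lemma l2_zero [simp]: "0 \<in> l2"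
  by (simp add: l2_def)

lemma l2_add [intro]:
  assumes "F \<in> l2" "G \<in> l2"
  shows "F + G \<in> l2"
proof -
  have "summable (\<lambda>n. 2 * (cmod (fps_nth F n))\<^sup>2 + 2 * (cmod (fps_nth G n))\<^sup>2)"
    using assms by (intro summable_add summable_mult) (auto simp: l2_def)
  then have "summable (\<lambda>n. (cmod (fps_nth F n + fps_nth G n))\<^sup>2)"
    by (rule summable_comparison_test') (simp add: norm_add_sq_le)
  then show ?thesis
    by (simp add: l2_def)
qed

lemma l2_cmult [intro]:
  assumes "F \<in> l2"
  shows "fps_const c * F \<in> l2"
  using assms by (auto simp: l2_def norm_mult power_mult_distrib intro: summable_mult)

lemma l2_uminus [intro]: "F \<in> l2 \<Longrightarrow> - F \<in> l2"
  by (simp add: l2_def)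

lemma l2_diff [intro]: "F \<in> l2 \<Longrightarrow> G \<in> l2 \<Longrightarrow> F - G \<in> l2"
  using l2_add[of F "- G"] l2_uminus[of G] by simp

lemma l2_shift [intro]: "F \<in> l2 \<Longrightarrow> fps_shift k F \<in> l2"
  using summable_ignore_initial_segment[of "\<lambda>n. (cmod (fps_nth F n))\<^sup>2" k]
  by (simp add: l2_def)

lemma l2_X_power_mult [intro]:
  assumes "F \<in> l2"
  shows "fps_X ^ k * F \<in> l2"
proof -
  have "summable (\<lambda>n. (cmod (fps_nth (fps_X ^ k * F) (n + k)))\<^sup>2)"
    using assms by (simp add: l2_def fps_X_power_mult_nth)
  then show ?thesis
    unfolding l2_def using summable_iff_shift by blast
qed

lemma l2_X_mult [intro]: "F \<in> l2 \<Longrightarrow> fps_X * F \<in> l2"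
  using l2_X_power_mult[of F 1] by simp

lemma l2_cutoff [simp, intro]: "fps_cutoff n F \<in> l2"
proof -
  have "summable (\<lambda>k. (cmod (fps_nth (fps_cutoff n F) k))\<^sup>2)"
    by (rule summable_finite[of "{..<n}"]) auto
  then show ?thesis by (simp add: l2_def)
qed

lemma l2_const [simp, intro]: "fps_const c \<in> l2"
proof -
  have "fps_const c = fps_cutoff 1 (fps_const c)" by (simp add: fps_eq_iff)
  then show ?thesis by (metis l2_cutoff)
qed

lemma l2_one [simp, intro]: "1 \<in> l2"
  using l2_const[of 1] by simp

lemma l2_X_power [simp, intro]: "fps_X ^ n \<in> l2"
  using l2_X_power_mult[of 1 n] by simp

lemma l2_X [simp, intro]: "fps_X \<in> l2"
  using l2_X_power[of 1] by simp

lemma l2_sum [intro]: "(\<And>i. i \<in> I \<Longrightarrow> F i \<in> l2) \<Longrightarrow> (\<Sum>i\<in>I. F i) \<in> l2"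
  by (induction I rule: infinite_finite_induct) auto

section \<open>Inner product and norm\<close>

lemma summable_norm_l2_inner:
  assumes "F \<in> l2" "G \<in> l2"
  shows "summable (\<lambda>n. cmod (fps_nth F n) * cmod (fps_nth G n))"
proof (rule summable_comparison_test')
  show "summable (\<lambda>n. (cmod (fps_nth F n))\<^sup>2 + (cmod (fps_nth G n))\<^sup>2)"
    using assms by (intro summable_add) (auto simp: l2_def)
  show "norm (cmod (fps_nth F n) * cmod (fps_nth G n))
          \<le> (cmod (fps_nth F n))\<^sup>2 + (cmod (fps_nth G n))\<^sup>2" for n
  proof -
    have "0 \<le> cmod (fps_nth F n) * cmod (fps_nth G n)"
      by (rule mult_nonneg_nonneg) auto
    then show ?thesis
      using sum_squares_bound[of "cmod (fps_nth F n)" "cmod (fps_nth G n)"]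
      unfolding real_norm_def abs_of_nonneg[OF \<open>0 \<le> _\<close>] by linarith
  qed
qed

lemma summable_l2_inner:
  assumes "F \<in> l2" "G \<in> l2"
  shows "summable (\<lambda>n. fps_nth F n * cnj (fps_nth G n))"
  by (rule summable_norm_cancel) (use summable_norm_l2_inner[OF assms] in \<open>simp add: norm_mult\<close>)

lemma l2_inner_add_left:
  assumes "F \<in> l2" "G \<in> l2" "K \<in> l2"
  shows "l2_inner (F + G) K = l2_inner F K + l2_inner G K"
  using assms by (simp add: l2_inner_def ring_distribs suminf_add summable_l2_inner)

lemma l2_inner_diff_left:
  assumes "F \<in> l2" "G \<in> l2" "K \<in> l2"
  shows "l2_inner (F - G) K = l2_inner F K - l2_inner G K"
  using assms by (simp add: l2_inner_def left_diff_distrib suminf_diff summable_l2_inner)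

lemma l2_inner_cmult_left:
  assumes "F \<in> l2" "K \<in> l2"
  shows "l2_inner (fps_const c * F) K = c * l2_inner F K"
  using assms by (simp add: l2_inner_def mult.assoc suminf_mult summable_l2_inner)

lemma l2_inner_commute:
  assumes "F \<in> l2" "G \<in> l2"
  shows "l2_inner F G = cnj (l2_inner G F)"
proof -
  have "(\<lambda>n. fps_nth G n * cnj (fps_nth F n)) sums l2_inner G F"
    using summable_l2_inner[OF assms(2,1)] by (simp add: l2_inner_def summable_sums)
  then have "(\<lambda>n. fps_nth F n * cnj (fps_nth G n)) sums cnj (l2_inner G F)"
    using sums_cnj by (fastforce simp: mult.commute)
  then show ?thesis
    by (simp add: l2_inner_def sums_iff)
qed

lemma l2_inner_add_right:
  assumes "F \<in> l2" "G \<in> l2" "K \<in> l2"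
  shows "l2_inner K (F + G) = l2_inner K F + l2_inner K G"
  using assms by (metis complex_cnj_add l2_add l2_inner_add_left l2_inner_commute)

lemma l2_inner_diff_right:
  assumes "F \<in> l2" "G \<in> l2" "K \<in> l2"
  shows "l2_inner K (F - G) = l2_inner K F - l2_inner K G"
  using assms by (metis complex_cnj_diff l2_diff l2_inner_diff_left l2_inner_commute)

lemma l2_inner_cmult_right:
  assumes "F \<in> l2" "K \<in> l2"
  shows "l2_inner K (fps_const c * F) = cnj c * l2_inner K F"
  using assms by (metis complex_cnj_mult l2_cmult l2_inner_cmult_left l2_inner_commute)

lemma l2_inner_zero_left [simp]: "l2_inner 0 F = 0"
  by (simp add: l2_inner_def)

lemma l2_inner_zero_right [simp]: "l2_inner F 0 = 0"
  by (simp add: l2_inner_def)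

lemma l2_inner_sum_left:
  assumes "\<And>i. i \<in> I \<Longrightarrow> F i \<in> l2" "K \<in> l2"
  shows "l2_inner (\<Sum>i\<in>I. F i) K = (\<Sum>i\<in>I. l2_inner (F i) K)"
  using assms by (induction I rule: infinite_finite_induct) (auto simp: l2_inner_add_left l2_sum)

lemma l2_inner_self:
  assumes "F \<in> l2"
  shows "l2_inner F F = of_real (l2_normsq F)"
proof -
  have "(\<lambda>n. (cmod (fps_nth F n))\<^sup>2) sums l2_normsq F"
    using assms by (simp add: l2_normsq_def l2_def summable_sums)
  then have "(\<lambda>n. of_real ((cmod (fps_nth F n))\<^sup>2) :: complex) sums of_real (l2_normsq F)"
    by (rule sums_of_real)
  then have "(\<lambda>n. fps_nth F n * cnj (fps_nth F n)) sums of_real (l2_normsq F)"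
    by (simp flip: complex_norm_square)
  then show ?thesis
    by (simp add: l2_inner_def sums_iff)
qed

lemma l2_normsq_nonneg [simp]: "F \<in> l2 \<Longrightarrow> 0 \<le> l2_normsq F"
  by (auto simp: l2_normsq_def l2_def intro: suminf_nonneg)

lemma l2_normsq_eq_0_iff: "F \<in> l2 \<Longrightarrow> l2_normsq F = 0 \<longleftrightarrow> F = 0"
  using suminf_eq_zero_iff[of "\<lambda>n. (cmod (fps_nth F n))\<^sup>2"]
  by (simp add: l2_normsq_def l2_def fps_eq_iff)

lemma l2_inner_self_eq_0_iff: "F \<in> l2 \<Longrightarrow> l2_inner F F = 0 \<longleftrightarrow> F = 0"
  by (simp add: l2_inner_self l2_normsq_eq_0_iff)

lemma sum_le_l2_normsq: "F \<in> l2 \<Longrightarrow> (\<Sum>n<N. (cmod (fps_nth F n))\<^sup>2) \<le> l2_normsq F"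
  unfolding l2_normsq_def by (rule sum_le_suminf) (auto simp: l2_def)

lemma l2_Cauchy_Schwarz:
  assumes "F \<in> l2" "G \<in> l2"
  shows "(cmod (l2_inner F G))\<^sup>2 \<le> l2_normsq F * l2_normsq G"
proof -
  let ?h = "\<lambda>n. cmod (fps_nth F n) * cmod (fps_nth G n)"
  have "cmod (l2_inner F G) \<le> suminf ?h"
    unfolding l2_inner_def
    using summable_norm[of "\<lambda>n. fps_nth F n * cnj (fps_nth G n)"] summable_norm_l2_inner[OF assms]
    by (simp add: norm_mult)
  also have "\<dots> \<le> sqrt (l2_normsq F * l2_normsq G)"
  proof (rule suminf_le_const[OF summable_norm_l2_inner[OF assms]])
    fix N
    have "(\<Sum>n<N. ?h n)\<^sup>2 \<le> (\<Sum>n<N. (cmod (fps_nth F n))\<^sup>2) * (\<Sum>n<N. (cmod (fps_nth G n))\<^sup>2)"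
      by (rule Cauchy_Schwarz_ineq_sum)
    also have "\<dots> \<le> l2_normsq F * l2_normsq G"
      using assms by (intro mult_mono sum_le_l2_normsq) (auto intro: sum_nonneg)
    finally show "(\<Sum>n<N. ?h n) \<le> sqrt (l2_normsq F * l2_normsq G)"
      by (rule real_le_rsqrt)
  qed
  finally have "(cmod (l2_inner F G))\<^sup>2 \<le> (sqrt (l2_normsq F * l2_normsq G))\<^sup>2"
    by (intro power_mono) auto
  then show ?thesis
    using assms by simp
qed

text \<open>The first \<open>k\<close> coefficients of the product vanish, so the backward shift is
  the adjoint of multiplication by \<open>fps_X ^ k\<close>. This later yields the adjoint of the
  squared compressed shift.\<close>

lemma l2_inner_X_power_mult_left:
  assumes "F \<in> l2" "G \<in> l2"
  shows "l2_inner (fps_X ^ k * F) G = l2_inner F (fps_shift k G)"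
proof -
  have "l2_inner (fps_X ^ k * F) G
      = (\<Sum>n. fps_nth (fps_X ^ k * F) (n + k) * cnj (fps_nth G (n + k)))"
    unfolding l2_inner_def
    by (subst suminf_split_initial_segment[of _ k])
       (use assms summable_l2_inner[of "fps_X ^ k * F" G] in \<open>auto simp: fps_X_power_mult_nth\<close>)
  then show ?thesis
    by (simp add: fps_X_power_mult_nth l2_inner_def)
qed

lemma l2_inner_X_power_mult_X_power_mult:
  assumes "F \<in> l2" "G \<in> l2"
  shows "l2_inner (fps_X ^ k * F) (fps_X ^ k * G) = l2_inner F G"
proof -
  have "fps_shift k (fps_X ^ k * G) = G"
    by (simp add: fps_eq_iff fps_X_power_mult_nth)
  then show ?thesis
    using assms by (simp add: l2_inner_X_power_mult_left l2_X_power_mult)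
qed

text \<open>The squared distance is the tail of a convergent series. With it, identities checked on
  polynomials extend to \<open>l2\<close>.\<close>

lemma l2_normsq_diff_cutoff_tendsto:
  assumes "F \<in> l2"
  shows "(\<lambda>N. l2_normsq (fps_cutoff N F - F)) \<longlonglongrightarrow> 0"
proof -
  let ?f = "\<lambda>n. (cmod (fps_nth F n))\<^sup>2"
  have eq: "l2_normsq (fps_cutoff N F - F) = suminf ?f - (\<Sum>n<N. ?f n)" for N
  proof -
    have "fps_cutoff N F - F \<in> l2"
      using assms by auto
    then have "l2_normsq (fps_cutoff N F - F)
        = (\<Sum>n. (cmod (fps_nth (fps_cutoff N F - F) (n + N)))\<^sup>2)"
      unfolding l2_normsq_def by (subst suminf_split_initial_segment[of _ N]) (auto simp: l2_def)
    also have "\<dots> = suminf ?f - (\<Sum>n<N. ?f n)"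
      using suminf_minus_initial_segment[OF l2D[OF assms], of N] by simp
    finally show ?thesis .
  qed
  have "(\<lambda>N. suminf ?f - (\<Sum>n<N. ?f n)) \<longlonglongrightarrow> suminf ?f - suminf ?f"
    using summable_LIMSEQ[OF l2D[OF assms]] by (intro tendsto_diff tendsto_const)
  then show ?thesis
    by (simp add: eq)
qed

lemma l2_inner_tendsto_left:
  assumes "(\<lambda>N. l2_normsq (s N - F)) \<longlonglongrightarrow> 0" "\<And>N. s N \<in> l2" "F \<in> l2" "G \<in> l2"
  shows "(\<lambda>N. l2_inner (s N) G) \<longlonglongrightarrow> l2_inner F G"
proof -
  have "(\<lambda>N. l2_normsq (s N - F) * l2_normsq G) \<longlonglongrightarrow> 0"
    using tendsto_mult_left_zero[OF assms(1)] by simp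
  moreover have "\<forall>\<^sub>F N in sequentially.
      norm ((cmod (l2_inner (s N - F) G))\<^sup>2) \<le> l2_normsq (s N - F) * l2_normsq G"
    using l2_Cauchy_Schwarz[of "s _ - F" G] assms by (intro always_eventually) auto
  ultimately have "(\<lambda>N. (cmod (l2_inner (s N - F) G))\<^sup>2) \<longlonglongrightarrow> 0"
    by (rule Lim_null_comparison[rotated])
  then have "(\<lambda>N. sqrt ((cmod (l2_inner (s N - F) G))\<^sup>2)) \<longlonglongrightarrow> sqrt 0"
    by (rule tendsto_real_sqrt)
  then have "(\<lambda>N. l2_inner (s N - F) G) \<longlonglongrightarrow> 0"
    by (simp add: tendsto_norm_zero_iff)
  then have "(\<lambda>N. l2_inner (s N) G - l2_inner F G) \<longlonglongrightarrow> 0"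
    using assms by (simp add: l2_inner_diff_left)
  then show ?thesis
    by (simp add: LIM_zero_iff)
qed

lemma l2_conv_radius:
  assumes "F \<in> l2"
  shows "fps_conv_radius F \<ge> 1"
  unfolding fps_conv_radius_def
proof (rule conv_radius_geI_ex')
  fix r :: real assume r: "0 < r" "ereal r < 1"
  have *: "(cmod (fps_nth F n))\<^sup>2 \<le> l2_normsq F" for n
    using sum_le_suminf[OF l2D[OF assms], of "{n}"] by (simp add: l2_normsq_def)
  have "cmod (fps_nth F n) \<le> sqrt (l2_normsq F)" for n
    using real_le_rsqrt[OF *] .
  then have "norm (fps_nth F n * of_real r ^ n) \<le> sqrt (l2_normsq F) * r ^ n" for n
    using r by (simp add: norm_mult norm_power mult_right_mono)
  moreover have "summable (\<lambda>n. sqrt (l2_normsq F) * r ^ n)"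
    using r by (intro summable_mult summable_geometric) (simp add: one_ereal_def)
  ultimately show "summable (\<lambda>n. fps_nth F n * of_real r ^ n)"
    by (rule summable_comparison_test'[rotated])
qed

lemma fps_cutoff_eq_sum: "fps_cutoff N F = (\<Sum>k<N. fps_const (fps_nth F k) * fps_X ^ k)"
proof (rule fps_ext)
  fix n
  show "fps_nth (fps_cutoff N F) n = fps_nth (\<Sum>k<N. fps_const (fps_nth F k) * fps_X ^ k) n"
    by (simp add: fps_sum_nth sum.delta mult_delta_right)
qed

section \<open>Isometric multipliers and their model spaces\<close>

text \<open>The coefficient form of an inner function: the family \<open>m * fps_X ^ n\<close> is
  orthonormal. Testing against \<open>m\<close> suffices, because multiplication by
  \<open>fps_X\<close> preserves inner products.\<close>

locale isometric_multiplier =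
  fixes m :: "complex fps"
  assumes m_l2: "m \<in> l2"
    and inner_mX_m: "l2_inner (m * fps_X ^ n) m = (if n = 0 then 1 else 0)"
begin

lemma mX_l2 [simp, intro]: "m * fps_X ^ n \<in> l2"
  using l2_X_power_mult[OF m_l2] by (simp add: mult.commute)

lemma inner_mX_mX: "l2_inner (m * fps_X ^ i) (m * fps_X ^ j) = (if i = j then 1 else 0)"
proof -
  have *: "l2_inner (m * fps_X ^ (j + k)) (m * fps_X ^ j) = (if k = 0 then 1 else 0)" for j k
    using l2_inner_X_power_mult_X_power_mult[of "m * fps_X ^ k" m j] m_l2 inner_mX_m[of k]
    by (simp add: power_add mult_ac)
  show ?thesis
  proof (cases "j \<le> i")
    case True
    then show ?thesis using *[of j "i - j"] by auto
  next
    case False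
    then have "l2_inner (m * fps_X ^ j) (m * fps_X ^ i) = 0"
      using *[of i "j - i"] by auto
    then show ?thesis
      using False l2_inner_commute[of "m * fps_X ^ i" "m * fps_X ^ j"] by auto
  qed
qed

lemma m_mult_cutoff: "m * fps_cutoff N G = (\<Sum>k<N. fps_const (fps_nth G k) * (m * fps_X ^ k))"
  by (simp add: fps_cutoff_eq_sum sum_distrib_left mult_ac)

lemma m_mult_cutoff_l2 [simp, intro]: "m * fps_cutoff N G \<in> l2"
  unfolding m_mult_cutoff by auto

lemma inner_m_cutoff_left:
  assumes "F \<in> l2"
  shows "l2_inner (m * fps_cutoff N G) F = (\<Sum>k<N. fps_nth G k * l2_inner (m * fps_X ^ k) F)"
  unfolding m_mult_cutoff using assms
  by (subst l2_inner_sum_left) (auto simp: l2_inner_cmult_left)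

lemma inner_m_cutoff_mX:
  "l2_inner (m * fps_cutoff N G) (m * fps_X ^ n) = (if n < N then fps_nth G n else 0)"
  by (simp add: inner_m_cutoff_left inner_mX_mX mult_delta_right sum.delta')

lemma normsq_m_cutoff: "l2_normsq (m * fps_cutoff N G) = (\<Sum>k<N. (cmod (fps_nth G k))\<^sup>2)"
proof -
  have "of_real (l2_normsq (m * fps_cutoff N G))
      = (\<Sum>k<N. fps_nth G k * cnj (l2_inner (m * fps_cutoff N G) (m * fps_X ^ k)))"
    using l2_inner_commute[OF mX_l2 m_mult_cutoff_l2]
    by (simp add: l2_inner_self[symmetric] inner_m_cutoff_left)
  also have "\<dots> = of_real (\<Sum>k<N. (cmod (fps_nth G k))\<^sup>2)"
    unfolding of_real_sum by (rule sum.cong) (auto simp: inner_m_cutoff_mX simp flip: complex_norm_square)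
  finally show ?thesis
    using of_real_eq_iff by blast
qed

lemma m_mult_nth_cutoff: "k < N \<Longrightarrow> fps_nth (m * G) k = fps_nth (m * fps_cutoff N G) k"
  unfolding fps_mult_nth by (rule sum.cong) auto

text \<open>Membership of \<open>m * G\<close> in \<open>l2\<close> is not yet known, so the bound
  goes through polynomials: coefficients below \<open>N\<close> depend only on
  \<open>fps_cutoff N G\<close>, and the norm of \<open>m * fps_cutoff N G\<close> is computed by
  orthonormality.\<close>

lemma sum_m_mult_le:
  assumes "G \<in> l2"
  shows "(\<Sum>k<N. (cmod (fps_nth (m * G) k))\<^sup>2) \<le> l2_normsq G"
proof -
  have "(\<Sum>k<N. (cmod (fps_nth (m * G) k))\<^sup>2) = (\<Sum>k<N. (cmod (fps_nth (m * fps_cutoff N G) k))\<^sup>2)"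
    by (intro sum.cong refl) (simp only: lessThan_iff m_mult_nth_cutoff[of _ N G])
  also have "\<dots> \<le> l2_normsq (m * fps_cutoff N G)"
    by (rule sum_le_l2_normsq) auto
  also have "\<dots> \<le> l2_normsq G"
    unfolding normsq_m_cutoff using assms by (rule sum_le_l2_normsq)
  finally show ?thesis .
qed

lemma m_mult_l2 [intro]:
  assumes "G \<in> l2"
  shows "m * G \<in> l2"
  using sum_m_mult_le[OF assms] by (rule l2I)

lemma normsq_m_mult_le:
  assumes "G \<in> l2"
  shows "l2_normsq (m * G) \<le> l2_normsq G"
  unfolding l2_normsq_def[of "m * G"]
  by (rule suminf_le_const) (use assms m_mult_l2[OF assms] sum_m_mult_le in \<open>auto simp: l2_def\<close>)

lemma m_mult_cutoff_tendsto:
  assumes "G \<in> l2"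
  shows "(\<lambda>N. l2_normsq (m * fps_cutoff N G - m * G)) \<longlonglongrightarrow> 0"
proof (rule Lim_null_comparison[OF _ l2_normsq_diff_cutoff_tendsto[OF assms]])
  have "l2_normsq (m * (fps_cutoff N G - G)) \<le> l2_normsq (fps_cutoff N G - G)" for N
    using assms by (intro normsq_m_mult_le) auto
  then show "\<forall>\<^sub>F N in sequentially. norm (l2_normsq (m * fps_cutoff N G - m * G))
      \<le> l2_normsq (fps_cutoff N G - G)"
    using assms m_mult_l2[of "fps_cutoff _ G - G"] l2_diff[OF l2_cutoff assms]
    by (intro always_eventually) (auto simp: right_diff_distrib)
qed

lemma inner_m_mult_mX:
  assumes "G \<in> l2"
  shows "l2_inner (m * G) (m * fps_X ^ n) = fps_nth G n"
proof (rule LIMSEQ_unique)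
  show "(\<lambda>N. l2_inner (m * fps_cutoff N G) (m * fps_X ^ n)) \<longlonglongrightarrow> l2_inner (m * G) (m * fps_X ^ n)"
    using assms by (intro l2_inner_tendsto_left m_mult_cutoff_tendsto) auto
  show "(\<lambda>N. l2_inner (m * fps_cutoff N G) (m * fps_X ^ n)) \<longlonglongrightarrow> fps_nth G n"
    unfolding inner_m_cutoff_mX
    by (rule tendsto_eventually) (use eventually_gt_at_top[of n] in \<open>eventually_elim, auto\<close>)
qed

text \<open>The adjoint of multiplication by \<open>m\<close>, through Fourier coefficients in the
  orthonormal family. As it is also a left inverse, \<open>m * m_adj F\<close> is the orthogonal
  projection of \<open>F\<close> onto the multiples of \<open>m\<close>.\<close>

definition m_adj :: "complex fps \<Rightarrow> complex fps" where
  "m_adj F = Abs_fps (\<lambda>n. l2_inner F (m * fps_X ^ n))"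

lemma m_adj_nth [simp]: "fps_nth (m_adj F) n = l2_inner F (m * fps_X ^ n)"
  by (simp add: m_adj_def)

lemma m_adj_mult: "G \<in> l2 \<Longrightarrow> m_adj (m * G) = G"
  by (simp add: fps_eq_iff inner_m_mult_mX)

text \<open>Bessel's inequality for the orthonormal family.\<close>

lemma m_adj_l2 [intro]:
  assumes "F \<in> l2"
  shows "m_adj F \<in> l2"
proof -
  have "(\<Sum>k<N. (cmod (fps_nth (m_adj F) k))\<^sup>2) \<le> l2_normsq F" for N
  proof -
    \<comment> \<open>\<open>D\<close> is the projection of \<open>F\<close> onto the span of the
      first \<open>N\<close> vectors \<open>m * fps_X ^ k\<close>, so the nonnegative number
      \<open>l2_normsq (F - D)\<close> is \<open>l2_normsq F - s\<close>.\<close>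
    define D where "D = m * fps_cutoff N (m_adj F)"
    define s where "s = (\<Sum>k<N. (cmod (fps_nth (m_adj F) k))\<^sup>2)"
    have D: "D \<in> l2" by (simp add: D_def)
    have DF: "l2_inner D F = of_real s"
      unfolding D_def s_def of_real_sum inner_m_cutoff_left[OF assms] using assms
      by (intro sum.cong) (auto simp: l2_inner_commute[OF _ assms] complex_norm_square simp del: of_real_power)
    then have FD: "l2_inner F D = of_real s"
      using l2_inner_commute[OF assms D] by simp
    have DD: "l2_inner D D = of_real s"
      using D by (simp add: l2_inner_self normsq_m_cutoff D_def s_def del: m_adj_nth)
    have "of_real (l2_normsq (F - D)) = (of_real (l2_normsq F - s) :: complex)"
      using assms D by (simp flip: l2_inner_self add: l2_diff l2_inner_diff_left l2_inner_diff_right DF FD DD)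
    then have "l2_normsq (F - D) = l2_normsq F - s"
      using of_real_eq_iff by blast
    then show ?thesis
      using l2_normsq_nonneg[OF l2_diff[OF assms D]] by (simp add: s_def)
  qed
  then show ?thesis
    by (rule l2I)
qed

lemma m_adj_add: "F \<in> l2 \<Longrightarrow> G \<in> l2 \<Longrightarrow> m_adj (F + G) = m_adj F + m_adj G"
  by (simp add: fps_eq_iff l2_inner_add_left)

lemma m_adj_diff: "F \<in> l2 \<Longrightarrow> G \<in> l2 \<Longrightarrow> m_adj (F - G) = m_adj F - m_adj G"
  by (simp add: fps_eq_iff l2_inner_diff_left)

lemma m_adj_cmult: "F \<in> l2 \<Longrightarrow> m_adj (fps_const c * F) = fps_const c * m_adj F"
  by (simp add: fps_eq_iff l2_inner_cmult_left)

section \<open>The model space and its orthogonal projection\<close>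

definition model :: "complex fps set" where
  "model = {F \<in> l2. \<forall>G\<in>l2. l2_inner F (m * G) = 0}"

definition model_proj :: "complex fps \<Rightarrow> complex fps" where
  "model_proj F = F - m * m_adj F"

lemma model_l2: "F \<in> model \<Longrightarrow> F \<in> l2"
  by (simp add: model_def)

lemma inner_model_m_mult: "F \<in> model \<Longrightarrow> G \<in> l2 \<Longrightarrow> l2_inner F (m * G) = 0"
  by (simp add: model_def)

lemma inner_m_mult_model: "F \<in> model \<Longrightarrow> G \<in> l2 \<Longrightarrow> l2_inner (m * G) F = 0"
  using l2_inner_commute[of "m * G" F] by (simp add: inner_model_m_mult model_l2 m_mult_l2)

lemma model_proj_l2 [intro]: "F \<in> l2 \<Longrightarrow> model_proj F \<in> l2"
  by (auto simp: model_proj_def)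

text \<open>Subtracting \<open>m * m_adj F\<close> cancels the coefficient against each
  \<open>m * fps_X ^ n\<close>; cutoffs and continuity of the inner product extend the orthogonality
  to all \<open>m * G\<close>.\<close>

lemma model_proj_in_model [intro]:
  assumes "F \<in> l2"
  shows "model_proj F \<in> model"
proof -
  have X: "l2_inner (m * fps_X ^ n) (model_proj F) = 0" for n
  proof -
    have "l2_inner (model_proj F) (m * fps_X ^ n) = 0"
      using assms unfolding model_proj_def
      by (subst l2_inner_diff_left) (auto simp: inner_m_mult_mX m_adj_l2)
    then show ?thesis
      using assms l2_inner_commute[of "m * fps_X ^ n" "model_proj F"] by auto
  qed
  have "l2_inner (model_proj F) (m * G) = 0" if G: "G \<in> l2" for G
  proof -
    have "(\<lambda>N. l2_inner (m * fps_cutoff N G) (model_proj F)) \<longlonglongrightarrow> l2_inner (m * G) (model_proj F)"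
      using assms G by (intro l2_inner_tendsto_left m_mult_cutoff_tendsto) auto
    then have "l2_inner (m * G) (model_proj F) = 0"
      using assms X by (simp add: inner_m_cutoff_left model_proj_l2 LIMSEQ_const_iff)
    then show ?thesis
      using assms G l2_inner_commute[of "model_proj F" "m * G"] by auto
  qed
  then show ?thesis
    using assms by (auto simp: model_def)
qed

lemma model_add [intro]: "F \<in> model \<Longrightarrow> G \<in> model \<Longrightarrow> F + G \<in> model"
  by (auto simp: model_def l2_inner_add_left m_mult_l2)

lemma model_diff [intro]: "F \<in> model \<Longrightarrow> G \<in> model \<Longrightarrow> F - G \<in> model"
  by (auto simp: model_def l2_inner_diff_left m_mult_l2)

lemma model_cmult [intro]: "F \<in> model \<Longrightarrow> fps_const c * F \<in> model"
  by (auto simp: model_def l2_inner_cmult_left m_mult_l2)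

lemma zero_in_model [simp]: "0 \<in> model"
  by (simp add: model_def)

lemma model_closed:
  assumes "\<And>n. s n \<in> model" "F \<in> l2" "(\<lambda>n. l2_normsq (s n - F)) \<longlonglongrightarrow> 0"
  shows "F \<in> model"
proof -
  have "l2_inner F (m * G) = 0" if "G \<in> l2" for G
  proof -
    have "(\<lambda>n. l2_inner (s n) (m * G)) \<longlonglongrightarrow> l2_inner F (m * G)"
      using assms that by (intro l2_inner_tendsto_left) (auto simp: model_l2)
    then show ?thesis
      using assms(1) that by (simp add: inner_model_m_mult LIMSEQ_const_iff)
  qed
  then show ?thesis
    using assms(2) by (simp add: model_def)
qed

text \<open>The multiples of \<open>m\<close> are stable under \<open>fps_X ^ k\<close>, so their
  orthogonal complement is stable under the adjoint.\<close>

lemma model_shift [intro]: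
  assumes "F \<in> model"
  shows "fps_shift k F \<in> model"
proof -
  have "l2_inner (fps_shift k F) (m * G) = 0" if G: "G \<in> l2" for G
  proof -
    have "l2_inner (m * G) (fps_shift k F) = l2_inner (m * (fps_X ^ k * G)) F"
      using assms G l2_inner_X_power_mult_left[of "m * G" F k]
      by (auto simp: model_l2 m_mult_l2 mult.left_commute)
    also have "\<dots> = 0"
      using assms G by (intro inner_m_mult_model) auto
    finally show ?thesis
      using assms G l2_inner_commute[of "fps_shift k F" "m * G"]
      by (simp add: model_l2 l2_shift m_mult_l2)
  qed
  then show ?thesis
    using assms by (auto simp: model_def)
qed

lemma model_inter_m_mult:
  assumes "m * G \<in> model" "G \<in> l2"
  shows "m * G = 0"
  using inner_model_m_mult[OF assms] l2_inner_self_eq_0_iff[of "m * G"] assms(2) by auto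

lemma model_proj_add: "F \<in> l2 \<Longrightarrow> G \<in> l2 \<Longrightarrow> model_proj (F + G) = model_proj F + model_proj G"
  by (simp add: model_proj_def m_adj_add algebra_simps)

lemma model_proj_diff: "F \<in> l2 \<Longrightarrow> G \<in> l2 \<Longrightarrow> model_proj (F - G) = model_proj F - model_proj G"
  by (simp add: model_proj_def m_adj_diff algebra_simps)

lemma model_proj_cmult: "F \<in> l2 \<Longrightarrow> model_proj (fps_const c * F) = fps_const c * model_proj F"
  by (simp add: model_proj_def m_adj_cmult right_diff_distrib mult.left_commute)

lemma model_proj_m_mult: "G \<in> l2 \<Longrightarrow> model_proj (m * G) = 0"
  by (simp add: model_proj_def m_adj_mult)

lemma model_proj_model: "F \<in> model \<Longrightarrow> model_proj F = F"
  using inner_model_m_mult[of F "fps_X ^ _"]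
  by (simp add: model_proj_def m_adj_def fps_zero_def[symmetric])

lemma inner_model_proj_left:
  assumes "F \<in> l2" "G \<in> model"
  shows "l2_inner (model_proj F) G = l2_inner F G"
  using assms by (simp add: model_proj_def l2_inner_diff_left m_mult_l2 m_adj_l2 model_l2 inner_m_mult_model)

text \<open>Pythagoras for the splitting of \<open>F\<close> into its model part and a multiple of
  \<open>m\<close>.\<close>

lemma normsq_model_proj_le:
  assumes "F \<in> l2"
  shows "l2_normsq (model_proj F) \<le> l2_normsq F"
proof -
  let ?p = "model_proj F" and ?q = "m * m_adj F"
  have p: "?p \<in> l2" "?p \<in> model" and q: "?q \<in> l2"
    using assms by auto
  have F: "F = ?p + ?q"
    by (simp add: model_proj_def)
  have "l2_inner F F = l2_inner ?p ?p + l2_inner ?q ?q"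
    using p q assms by (subst (1 2) F)
      (simp add: l2_inner_add_left l2_inner_add_right l2_add inner_model_m_mult inner_m_mult_model m_adj_l2)
  then have "of_real (l2_normsq F) = (of_real (l2_normsq ?p + l2_normsq ?q) :: complex)"
    using p q assms by (simp add: l2_inner_self)
  then have "l2_normsq F = l2_normsq ?p + l2_normsq ?q"
    using of_real_eq_iff by blast
  then show ?thesis
    using l2_normsq_nonneg[OF q] by linarith
qed

text \<open>The part discarded by the inner projection is a multiple of \<open>m\<close>, stays one
  after multiplication by \<open>fps_X ^ k\<close>, and is killed. Hence the square of the
  compressed shift is the compression of \<open>fps_X\<^sup>2\<close>.\<close>

lemma model_proj_X_power_mult:
  assumes "F \<in> l2"
  shows "model_proj (fps_X ^ k * model_proj F) = model_proj (fps_X ^ k * F)"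
proof -
  have "fps_X ^ k * model_proj F = fps_X ^ k * F - m * (fps_X ^ k * m_adj F)"
    by (simp add: model_proj_def algebra_simps)
  then show ?thesis
    using assms by (simp add: model_proj_diff l2_X_power_mult m_mult_l2 m_adj_l2 model_proj_m_mult)
qed

end

section \<open>Projections onto pairs of coefficients\<close>

definition lin :: "complex \<Rightarrow> complex \<Rightarrow> complex fps" where
  "lin a b = fps_const a + fps_const b * fps_X"

definition even_fps :: "complex fps \<Rightarrow> bool" where
  "even_fps U \<longleftrightarrow> (\<forall>n. odd n \<longrightarrow> fps_nth U n = 0)"

text \<open>Read a series as a sequence of vectors in C^2, formed by the coefficients at
  \<open>2 * k\<close> and \<open>Suc (2 * k)\<close>. The component of each vector along
  \<open>(a, b)\<close> is stored at the even index, so that multiplying the resulting even series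
  by \<open>lin a b\<close> rebuilds vectors along \<open>(a, b)\<close>.\<close>

definition pair_coeff :: "complex \<Rightarrow> complex \<Rightarrow> complex fps \<Rightarrow> complex fps" where
  "pair_coeff a b F = Abs_fps (\<lambda>n. if even n
     then fps_nth F n * cnj a + fps_nth F (Suc n) * cnj b else 0)"

definition pair_proj :: "complex \<Rightarrow> complex \<Rightarrow> complex fps \<Rightarrow> complex fps" where
  "pair_proj a b F = lin a b * pair_coeff a b F"

lemma lin_l2 [simp, intro]: "lin a b \<in> l2"
  unfolding lin_def by auto

lemma lin_nth: "fps_nth (lin a b) n = (if n = 0 then a else if n = 1 then b else 0)"
  by (auto simp: lin_def)

lemma lin_eq_0_iff: "lin a b = 0 \<longleftrightarrow> a = 0 \<and> b = 0"
proof
  assume "lin a b = 0"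
  then have "fps_nth (lin a b) 0 = 0" "fps_nth (lin a b) 1 = 0"
    by simp_all
  then show "a = 0 \<and> b = 0" by (simp add: lin_nth)
qed (simp add: lin_def)

lemma lin_mult_nth: "fps_nth (lin a b * U) n = a * fps_nth U n + (if n = 0 then 0 else b * fps_nth U (n - 1))"
  by (simp add: lin_def distrib_right mult.assoc)

lemma lin_mult_even_nth:
  assumes "even_fps U"
  shows "fps_nth (lin a b * U) (2 * k) = a * fps_nth U (2 * k)"
    and "fps_nth (lin a b * U) (Suc (2 * k)) = b * fps_nth U (2 * k)"
  using assms by (simp_all add: lin_mult_nth even_fps_def)

lemma fps_pair_ext:
  assumes "\<And>k. fps_nth F (2 * k) = fps_nth G (2 * k)"
    and "\<And>k. fps_nth F (Suc (2 * k)) = fps_nth G (Suc (2 * k))"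
  shows "F = G"
proof (rule fps_ext)
  fix n show "fps_nth F n = fps_nth G n"
    using assms by (cases "even n") (auto elim!: evenE oddE)
qed

lemma even_pair_coeff [simp]: "even_fps (pair_coeff a b F)"
  by (simp add: pair_coeff_def even_fps_def)

lemma pair_coeff_nth: "fps_nth (pair_coeff a b F) (2 * k)
    = fps_nth F (2 * k) * cnj a + fps_nth F (Suc (2 * k)) * cnj b"
  by (simp add: pair_coeff_def)

lemma pair_proj_nth:
  "fps_nth (pair_proj a b F) (2 * k)
     = a * (fps_nth F (2 * k) * cnj a + fps_nth F (Suc (2 * k)) * cnj b)"
  "fps_nth (pair_proj a b F) (Suc (2 * k))
     = b * (fps_nth F (2 * k) * cnj a + fps_nth F (Suc (2 * k)) * cnj b)"
  by (simp_all add: pair_proj_def lin_mult_even_nth pair_coeff_nth)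

lemma pair_proj_add: "pair_proj a b (F + G) = pair_proj a b F + pair_proj a b G"
  by (rule fps_pair_ext) (simp_all add: pair_proj_nth, simp_all add: algebra_simps)

lemma pair_proj_diff: "pair_proj a b (F - G) = pair_proj a b F - pair_proj a b G"
  by (rule fps_pair_ext) (simp_all add: pair_proj_nth, simp_all add: algebra_simps)

lemma pair_proj_cmult: "pair_proj a b (fps_const c * F) = fps_const c * pair_proj a b F"
  by (rule fps_pair_ext) (simp_all add: pair_proj_nth, simp_all add: algebra_simps)

lemma pair_proj_0 [simp]: "pair_proj a b 0 = 0"
  by (rule fps_pair_ext) (simp_all add: pair_proj_nth)

lemma X2_mult_nth:
  "fps_nth (fps_X\<^sup>2 * F) (2 * k) = (if k = 0 then 0 else fps_nth F (2 * (k - 1)))"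
  "fps_nth (fps_X\<^sup>2 * F) (Suc (2 * k)) = (if k = 0 then 0 else fps_nth F (Suc (2 * (k - 1))))"
  by (cases k; simp add: fps_X_power_mult_nth)+

lemma pair_proj_X2_mult: "pair_proj a b (fps_X\<^sup>2 * F) = fps_X\<^sup>2 * pair_proj a b F"
  by (rule fps_pair_ext) (simp_all add: pair_proj_nth X2_mult_nth)

lemma pair_proj_shift2: "pair_proj a b (fps_shift 2 F) = fps_shift 2 (pair_proj a b F)"
proof (rule fps_pair_ext)
  fix k
  show "fps_nth (pair_proj a b (fps_shift 2 F)) (2 * k) = fps_nth (fps_shift 2 (pair_proj a b F)) (2 * k)"
    using pair_proj_nth(1)[of a b F "Suc k"] by (simp add: pair_proj_nth)
  show "fps_nth (pair_proj a b (fps_shift 2 F)) (Suc (2 * k))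
      = fps_nth (fps_shift 2 (pair_proj a b F)) (Suc (2 * k))"
    using pair_proj_nth(2)[of a b F "Suc k"] by (simp add: pair_proj_nth)
qed

text \<open>Norm one is stated as a complex identity, so that it can be multiplied by coefficients
  in ring computations.\<close>

locale unit_pair =
  fixes a b :: complex
  assumes unit: "a * cnj a + b * cnj b = 1"
begin

lemma unit_pair_perp: "unit_pair (- cnj b) (cnj a)"
  using unit by unfold_locales (simp add: algebra_simps)

text \<open>In C^2 the vector \<open>(- cnj b, cnj a)\<close> completes \<open>(a, b)\<close> to an
  orthonormal basis.\<close>

lemma pair_proj_perp: "pair_proj (- cnj b) (cnj a) F = F - pair_proj a b F"
proof (rule fps_pair_ext)
  fix k
  let ?x = "fps_nth F (2 * k)" and ?y = "fps_nth F (Suc (2 * k))"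
  have "cnj b * (b * ?x) = ?x - a * cnj a * ?x" "cnj a * (a * ?y) = ?y - b * cnj b * ?y"
    using arg_cong[OF unit, of "\<lambda>w. w * ?x"] arg_cong[OF unit, of "\<lambda>w. w * ?y"]
    by (simp_all add: algebra_simps)
  then show "fps_nth (pair_proj (- cnj b) (cnj a) F) (2 * k) = fps_nth (F - pair_proj a b F) (2 * k)"
    and "fps_nth (pair_proj (- cnj b) (cnj a) F) (Suc (2 * k)) = fps_nth (F - pair_proj a b F) (Suc (2 * k))"
    by (simp_all add: pair_proj_nth, simp_all add: algebra_simps)
qed

lemma lin_nonzero: "lin a b \<noteq> 0"
  using unit by (auto simp: lin_eq_0_iff)

lemma pair_proj_lin_mult:
  assumes "even_fps U"
  shows "pair_proj a b (lin a b * U) = lin a b * U"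
proof -
  have "a * z * cnj a + b * z * cnj b = z" for z
    using arg_cong[OF unit, of "\<lambda>w. w * z"] by (simp add: algebra_simps)
  then show ?thesis
    using assms by (intro fps_pair_ext) (simp_all add: pair_proj_nth lin_mult_even_nth)
qed

lemma pair_proj_idem: "pair_proj a b (pair_proj a b F) = pair_proj a b F"
  unfolding pair_proj_def[of a b F] by (simp add: pair_proj_lin_mult)

text \<open>The hypothesis is a vanishing determinant: every coefficient pair is parallel to
  \<open>(a, b)\<close>.\<close>

lemma pair_proj_fixI:
  assumes "\<And>k. fps_nth F (2 * k) * b = fps_nth F (Suc (2 * k)) * a"
  shows "pair_proj a b F = F"
proof (rule fps_pair_ext)
  fix k
  let ?x = "fps_nth F (2 * k)" and ?y = "fps_nth F (Suc (2 * k))"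
  have 1: "?x = a * cnj a * ?x + cnj b * (?x * b)" "?y = cnj a * (?y * a) + b * cnj b * ?y"
    using arg_cong[OF unit, of "\<lambda>w. w * ?x"] arg_cong[OF unit, of "\<lambda>w. w * ?y"]
    by (simp_all add: algebra_simps)
  have "fps_nth (pair_proj a b F) (2 * k) = a * cnj a * ?x + cnj b * (?x * b)"
    unfolding assms by (simp add: pair_proj_nth, simp add: algebra_simps)
  then show "fps_nth (pair_proj a b F) (2 * k) = ?x"
    using 1(1) by simp
  have "fps_nth (pair_proj a b F) (Suc (2 * k)) = cnj a * (?y * a) + b * cnj b * ?y"
    unfolding assms[symmetric] by (simp add: pair_proj_nth, simp add: algebra_simps)
  then show "fps_nth (pair_proj a b F) (Suc (2 * k)) = ?y"
    using 1(2) by simp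
qed

lemma norm_pair_coeff_le: "(cmod (x * cnj a + y * cnj b))\<^sup>2 \<le> (cmod x)\<^sup>2 + (cmod y)\<^sup>2"
proof -
  \<comment> \<open>Lagrange's identity: the defect in the Cauchy-Schwarz inequality on C^2 is the
    squared modulus of a determinant.\<close>
  have "complex_of_real ((cmod (x * cnj a + y * cnj b))\<^sup>2 + (cmod (y * a - x * b))\<^sup>2)
      = (x * cnj x + y * cnj y) * (a * cnj a + b * cnj b)"
    unfolding of_real_add complex_norm_square by (simp add: algebra_simps)
  also have "\<dots> = complex_of_real ((cmod x)\<^sup>2 + (cmod y)\<^sup>2)"
    unfolding of_real_add complex_norm_square unit by simp
  finally have "(cmod (x * cnj a + y * cnj b))\<^sup>2 + (cmod (y * a - x * b))\<^sup>2 = (cmod x)\<^sup>2 + (cmod y)\<^sup>2"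
    using of_real_eq_iff by blast
  then show ?thesis
    by (smt (verit) zero_le_power2)
qed

lemma norm_unit: "(cmod a)\<^sup>2 + (cmod b)\<^sup>2 = 1"
proof -
  have "complex_of_real ((cmod a)\<^sup>2 + (cmod b)\<^sup>2) = of_real 1"
    unfolding of_real_add complex_norm_square unit by simp
  then show ?thesis using of_real_eq_iff by blast
qed

text \<open>Ranges of length \<open>2 * N\<close> keep the pairs whole, so the inequality is checked
  pair by pair.\<close>

lemma sum_pair_proj_le:
  "(\<Sum>n<2 * N. (cmod (fps_nth (pair_proj a b F) n))\<^sup>2) \<le> (\<Sum>n<2 * N. (cmod (fps_nth F n))\<^sup>2)"
proof (induction N)
  case (Suc N)
  let ?x = "fps_nth F (2 * N)" and ?y = "fps_nth F (Suc (2 * N))"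
  have "(cmod (a * z))\<^sup>2 + (cmod (b * z))\<^sup>2 = (cmod z)\<^sup>2" for z
    using norm_unit by (simp add: norm_mult power_mult_distrib flip: distrib_right)
  then have "(cmod (fps_nth (pair_proj a b F) (2 * N)))\<^sup>2 + (cmod (fps_nth (pair_proj a b F) (Suc (2 * N))))\<^sup>2
      \<le> (cmod ?x)\<^sup>2 + (cmod ?y)\<^sup>2"
    by (simp add: pair_proj_nth norm_pair_coeff_le)
  then show ?case
    using Suc by simp
qed simp

lemma sum_pair_proj_le_normsq:
  assumes "F \<in> l2"
  shows "(\<Sum>n<N. (cmod (fps_nth (pair_proj a b F) n))\<^sup>2) \<le> l2_normsq F"
proof -
  have "(\<Sum>n<N. (cmod (fps_nth (pair_proj a b F) n))\<^sup>2)
      \<le> (\<Sum>n<2 * N. (cmod (fps_nth (pair_proj a b F) n))\<^sup>2)"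
    by (rule sum_mono2) auto
  then show ?thesis
    using sum_pair_proj_le[of F N] sum_le_l2_normsq[OF assms, of "2 * N"] by linarith
qed

lemma pair_proj_l2 [intro]: "F \<in> l2 \<Longrightarrow> pair_proj a b F \<in> l2"
  by (rule l2I[OF sum_pair_proj_le_normsq])

lemma pair_proj_selfadjoint:
  assumes "F \<in> l2" "G \<in> l2"
  shows "l2_inner (pair_proj a b F) G = l2_inner F (pair_proj a b G)"
proof -
  \<comment> \<open>Grouping the series by pairs reduces self-adjointness to C^2, where both sides
    agree term by term.\<close>
  have *: "(\<lambda>k. fps_nth F (2 * k) * cnj (fps_nth G (2 * k))
           + fps_nth F (Suc (2 * k)) * cnj (fps_nth G (Suc (2 * k)))) sums l2_inner F G"
    if "F \<in> l2" "G \<in> l2" for F G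
    using sums_group[OF summable_sums[OF summable_l2_inner[OF that]], of 2]
    by (simp add: l2_inner_def mult.commute[of _ "2::nat"])
  have "l2_inner (pair_proj a b F) G
      = (\<Sum>k. fps_nth (pair_proj a b F) (2 * k) * cnj (fps_nth G (2 * k))
           + fps_nth (pair_proj a b F) (Suc (2 * k)) * cnj (fps_nth G (Suc (2 * k))))"
    using *[OF pair_proj_l2 assms(2)] assms(1) by (simp add: sums_iff)
  also have "\<dots> = (\<Sum>k. fps_nth F (2 * k) * cnj (fps_nth (pair_proj a b G) (2 * k))
           + fps_nth F (Suc (2 * k)) * cnj (fps_nth (pair_proj a b G) (Suc (2 * k))))"
    by (rule arg_cong[where f = suminf], rule ext)
       (simp add: pair_proj_nth, simp add: algebra_simps)
  also have "\<dots> = l2_inner F (pair_proj a b G)"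
    using *[OF assms(1) pair_proj_l2] assms(2) by (simp add: sums_iff)
  finally show ?thesis .
qed

end

lemma unit_pair_normalize:
  assumes "x \<noteq> 0 \<or> y \<noteq> 0"
  obtains r a b where "r > 0" "unit_pair a b" "x = of_real r * a" "y = of_real r * b"
proof -
  define r where "r = sqrt ((cmod x)\<^sup>2 + (cmod y)\<^sup>2)"
  have r: "r > 0"
    unfolding r_def using assms by (auto intro: add_pos_nonneg add_nonneg_pos)
  have "x / r * cnj (x / r) + y / r * cnj (y / r) = of_real (((cmod x)\<^sup>2 + (cmod y)\<^sup>2) / r\<^sup>2)"
    unfolding of_real_divide of_real_add complex_norm_square
    by (simp add: add_divide_distrib power2_eq_square)
  also have "\<dots> = 1"
    using assms by (auto simp: r_def sum_power2_eq_zero_iff)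
  finally have "unit_pair (x / r) (y / r)"
    by unfold_locales
  then show thesis
    using that[of r "x / r" "y / r"] r by simp
qed

text \<open>For even \<open>V\<close> the product \<open>fps_X * V\<close> is odd, and a series both
  even and odd vanishes.\<close>

lemma even_X_mult_even_eq_0:
  assumes "even_fps U" "even_fps V" "U = fps_X * V"
  shows "U = 0"
proof (rule fps_ext)
  fix n
  show "fps_nth U n = fps_nth 0 n"
    using assms by (cases "even n") (auto simp: even_fps_def)
qed

section \<open>Reducing subspaces of the squared compressed shift\<close>

context isometric_multiplier
begin

text \<open>Reducing subspaces in coefficients: \<open>model_proj (fps_X\<^sup>2 * F)\<close> is the
  squared compressed shift and \<open>fps_shift 2\<close> its adjoint on
  \<open>model\<close>.\<close>

definition reducing :: "complex fps set \<Rightarrow> bool" where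
  "reducing N \<longleftrightarrow> N \<subseteq> model \<and> 0 \<in> N \<and> (\<forall>F\<in>N. \<forall>G\<in>N. F + G \<in> N) \<and> (\<forall>c. \<forall>F\<in>N. fps_const c * F \<in> N)
     \<and> (\<forall>s F. (\<forall>n. s n \<in> N) \<and> F \<in> l2 \<and> (\<lambda>n. l2_normsq (s n - F)) \<longlonglongrightarrow> 0 \<longrightarrow> F \<in> N)
     \<and> (\<forall>F\<in>N. model_proj (fps_X\<^sup>2 * F) \<in> N) \<and> (\<forall>F\<in>N. fps_shift 2 F \<in> N)"

lemma reducing_dest:
  assumes "reducing N"
  shows reducing_subset: "F \<in> N \<Longrightarrow> F \<in> model"
    and reducing_zero: "0 \<in> N"
    and reducing_add: "F \<in> N \<Longrightarrow> G \<in> N \<Longrightarrow> F + G \<in> N"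
    and reducing_cmult: "F \<in> N \<Longrightarrow> fps_const c * F \<in> N"
    and reducing_closed: "(\<And>n. s n \<in> N) \<Longrightarrow> F \<in> l2 \<Longrightarrow> (\<lambda>n. l2_normsq (s n - F)) \<longlonglongrightarrow> 0 \<Longrightarrow> F \<in> N"
    and reducing_X2: "F \<in> N \<Longrightarrow> model_proj (fps_X\<^sup>2 * F) \<in> N"
    and reducing_shift2: "F \<in> N \<Longrightarrow> fps_shift 2 F \<in> N"
  using assms unfolding reducing_def by blast+

lemma reducing_diff: "reducing N \<Longrightarrow> F \<in> N \<Longrightarrow> G \<in> N \<Longrightarrow> F - G \<in> N"
  using reducing_add[of N F "fps_const (- 1) * G"] reducing_cmult[of N G "- 1"]
  by (simp flip: fps_const_neg)

lemma reducing_shift: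
  assumes "reducing N" "F \<in> N"
  shows "fps_shift (2 * k) F \<in> N"
proof (induction k)
  case (Suc k)
  have "fps_shift (2 * Suc k) F = fps_shift 2 (fps_shift (2 * k) F)"
    by (simp add: fps_eq_iff add_ac)
  then show ?case
    using Suc reducing_shift2[OF assms(1)] by simp
qed (use assms in simp)

lemma reducing_proj_X_power:
  assumes "reducing N" "V \<in> l2" "model_proj V \<in> N"
  shows "model_proj (fps_X ^ (2 * k) * V) \<in> N"
proof (induction k)
  case (Suc k)
  have "model_proj (fps_X ^ (2 * Suc k) * V) = model_proj (fps_X\<^sup>2 * model_proj (fps_X ^ (2 * k) * V))"
    using assms model_proj_X_power_mult[of "fps_X ^ (2 * k) * V" 2]
    by (simp add: l2_X_power_mult power2_eq_square mult.assoc)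
  then show ?case
    using Suc reducing_X2[OF assms(1)] by simp
qed (use assms in simp)

text \<open>The element below is the defect operator \<open>1 - A A\<^sup>*\<close> of \<open>A = T\<^sup>2\<close> applied to \<open>F\<close>.\<close>

lemma reducing_proj_lin:
  assumes "reducing N" "F \<in> N"
  shows "model_proj (lin (fps_nth F 0) (fps_nth F 1)) \<in> N"
proof -
  have F: "F \<in> l2" "F \<in> model"
    using assms reducing_subset model_l2 by auto
  have "lin (fps_nth F 0) (fps_nth F 1) = F - fps_X\<^sup>2 * fps_shift 2 F"
  proof (rule fps_ext)
    fix n :: nat
    consider "n = 0" | "n = 1" | k where "n = k + 2"
      by (metis One_nat_def add.commute le_Suc_ex less_2_cases not_le)
    then show "fps_nth (lin (fps_nth F 0) (fps_nth F 1)) n = fps_nth (F - fps_X\<^sup>2 * fps_shift 2 F) n"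
      by cases (auto simp: lin_nth fps_X_power_mult_nth simp del: One_nat_def)
  qed
  then have "model_proj (lin (fps_nth F 0) (fps_nth F 1)) = F - model_proj (fps_X\<^sup>2 * fps_shift 2 F)"
    using F by (simp add: model_proj_diff model_proj_model l2_X_power_mult l2_shift)
  then show ?thesis
    using assms by (simp add: reducing_diff reducing_X2 reducing_shift2)
qed

text \<open>\<open>H\<close> is the norm limit of sums of blocks
  \<open>fps_X ^ (2 * n) * lin x y\<close>. Each projected block lies in \<open>N\<close> by
  iterating the operator; contractivity of \<open>model_proj\<close> and closedness of
  \<open>N\<close> give the limit.\<close>

lemma reducing_projI:
  assumes N: "reducing N" and H: "H \<in> l2"
    and pairs: "\<And>k. model_proj (lin (fps_nth H (2 * k)) (fps_nth H (Suc (2 * k)))) \<in> N"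
  shows "model_proj H \<in> N"
proof -
  have cutoff: "model_proj (fps_cutoff (2 * n) H) \<in> N" for n
  proof (induction n)
    case 0
    then show ?case
      using reducing_zero[OF N] model_proj_model[of 0] by simp
  next
    case (Suc n)
    have "fps_cutoff (2 * Suc n) H
        = fps_cutoff (2 * n) H + fps_X ^ (2 * n) * lin (fps_nth H (2 * n)) (fps_nth H (Suc (2 * n)))"
    proof (rule fps_ext)
      fix i
      consider "i < 2 * n" | "i = 2 * n" | "i = Suc (2 * n)" | "i > Suc (2 * n)" by linarith
      then show "fps_nth (fps_cutoff (2 * Suc n) H) i = fps_nth (fps_cutoff (2 * n) H
          + fps_X ^ (2 * n) * lin (fps_nth H (2 * n)) (fps_nth H (Suc (2 * n)))) i"
        by cases (auto simp: fps_X_power_mult_nth lin_nth)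
    qed
    then show ?case
      using Suc reducing_proj_X_power[OF N lin_l2 pairs] reducing_add[OF N]
      by (simp add: model_proj_add l2_X_power_mult)
  qed
  have "(\<lambda>n. l2_normsq (fps_cutoff (2 * n) H - H)) \<longlonglongrightarrow> 0"
    using LIMSEQ_subseq_LIMSEQ[OF l2_normsq_diff_cutoff_tendsto[OF H], of "\<lambda>n. 2 * n"]
    by (simp add: strict_mono_def o_def)
  moreover have "\<forall>\<^sub>F n in sequentially. norm (l2_normsq (model_proj (fps_cutoff (2 * n) H) - model_proj H))
      \<le> l2_normsq (fps_cutoff (2 * n) H - H)"
  proof (rule always_eventually, rule allI)
    fix n
    have *: "model_proj (fps_cutoff (2 * n) H) - model_proj H = model_proj (fps_cutoff (2 * n) H - H)"
      using H by (simp add: model_proj_diff)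
    have "fps_cutoff (2 * n) H - H \<in> l2"
      using H by auto
    then show "norm (l2_normsq (model_proj (fps_cutoff (2 * n) H) - model_proj H))
        \<le> l2_normsq (fps_cutoff (2 * n) H - H)"
      unfolding * using normsq_model_proj_le model_proj_l2 by simp
  qed
  ultimately have "(\<lambda>n. l2_normsq (model_proj (fps_cutoff (2 * n) H) - model_proj H)) \<longlonglongrightarrow> 0"
    by (rule Lim_null_comparison[rotated])
  then show ?thesis
    using H by (intro reducing_closed[OF N cutoff]) auto
qed

text \<open>Two independent pairs would span C^2. Then every projected linear polynomial would lie
  in \<open>N\<close>, and \<open>reducing_projI\<close> would give all of
  \<open>model\<close>.\<close>

lemma reducing_pairs_dependent:
  assumes N: "reducing N" and "N \<noteq> model" and FG: "F \<in> N" "G \<in> N"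
  shows "fps_nth F 0 * fps_nth G 1 = fps_nth F 1 * fps_nth G 0"
proof (rule ccontr)
  assume neq: "\<not> ?thesis"
  define d where "d = fps_nth F 0 * fps_nth G 1 - fps_nth F 1 * fps_nth G 0"
  have d: "d \<noteq> 0" using neq by (simp add: d_def)
  have lin: "model_proj (lin x y) \<in> N" for x y
  proof -
    \<comment> \<open>Cramer's rule for expressing \<open>(x, y)\<close> through the two coefficient
      pairs, with determinant \<open>d\<close>.\<close>
    define p where "p = (x * fps_nth G 1 - y * fps_nth G 0) / d"
    define q where "q = (y * fps_nth F 0 - x * fps_nth F 1) / d"
    have px: "p * fps_nth F 0 + q * fps_nth G 0 = x"
    proof -
      have "p * fps_nth F 0 + q * fps_nth G 0 = x * d / d"
        unfolding p_def q_def d_def times_divide_eq_left add_divide_distrib[symmetric]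
        by (simp add: algebra_simps)
      then show ?thesis using d by simp
    qed
    have py: "p * fps_nth F 1 + q * fps_nth G 1 = y"
    proof -
      have "p * fps_nth F 1 + q * fps_nth G 1 = y * d / d"
        unfolding p_def q_def d_def times_divide_eq_left add_divide_distrib[symmetric]
        by (simp add: algebra_simps)
      then show ?thesis using d by simp
    qed
    have "lin x y = fps_const p * lin (fps_nth F 0) (fps_nth F 1)
        + fps_const q * lin (fps_nth G 0) (fps_nth G 1)"
      by (rule fps_ext) (use px py in \<open>auto simp: lin_nth\<close>)
    then have "model_proj (lin x y) = fps_const p * model_proj (lin (fps_nth F 0) (fps_nth F 1))
        + fps_const q * model_proj (lin (fps_nth G 0) (fps_nth G 1))"
      by (simp add: model_proj_add model_proj_cmult l2_cmult)
    then show ?thesis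
      using N FG by (simp only: reducing_add reducing_cmult reducing_proj_lin)
  qed
  have "H \<in> N" if "H \<in> model" for H
    using reducing_projI[OF N model_l2[OF that] lin] model_proj_model[OF that] by simp
  then show False
    using assms(2) reducing_subset[OF N] by blast
qed

text \<open>The coefficient pairs of elements of \<open>N\<close> lie on one line with unit
  direction \<open>(a, b)\<close>. Thus \<open>pair_proj a b\<close> fixes \<open>N\<close>, while
  \<open>model_proj\<close> sends its range into \<open>N\<close>; together these force it to
  preserve the multiples of \<open>m\<close>.\<close>

theorem reducing_imp_pair_proj_invariant:
  assumes N: "reducing N" and N0: "N \<noteq> {0}" and Nm: "N \<noteq> model"
  obtains a b where "unit_pair a b" "\<And>h. h \<in> l2 \<Longrightarrow> \<exists>g\<in>l2. pair_proj a b (m * h) = m * g"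
proof -
  obtain x where "x \<in> N" "x \<noteq> 0"
    using N0 reducing_zero[OF N] by blast
  then obtain n where x: "x \<in> N" "fps_nth x n \<noteq> 0"
    using fps_nonzero_nth by blast
  \<comment> \<open>An even shift keeps the pairs aligned and brings the pair containing index
    \<open>n\<close> to indices 0 and 1.\<close>
  define y where "y = fps_shift (2 * (n div 2)) x"
  have y: "y \<in> N"
    unfolding y_def using reducing_shift[OF N x(1)] .
  have "fps_nth y 0 \<noteq> 0 \<or> fps_nth y 1 \<noteq> 0"
    using x(2) unfolding y_def by (cases "even n") (auto elim!: evenE oddE)
  then obtain r a b where r: "r > 0" and ab: "unit_pair a b"
    and y01: "fps_nth y 0 = of_real r * a" "fps_nth y 1 = of_real r * b"
    using unit_pair_normalize by blast
  interpret unit_pair a b by fact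
  have lin: "model_proj (lin (c * a) (c * b)) \<in> N" for c
  proof -
    have "lin (c * a) (c * b) = fps_const (c / r) * lin (fps_nth y 0) (fps_nth y 1)"
      by (rule fps_ext) (use r in \<open>auto simp: lin_nth y01 simp del: One_nat_def\<close>)
    then show ?thesis
      using reducing_cmult[OF N reducing_proj_lin[OF N y]] by (simp add: model_proj_cmult)
  qed
  have fixN: "pair_proj a b F = F" if "F \<in> N" for F
  proof (rule pair_proj_fixI)
    fix k
    have "fps_nth (fps_shift (2 * k) F) 0 * fps_nth y 1 = fps_nth (fps_shift (2 * k) F) 1 * fps_nth y 0"
      by (rule reducing_pairs_dependent[OF N Nm reducing_shift[OF N that] y])
    then show "fps_nth F (2 * k) * b = fps_nth F (Suc (2 * k)) * a"
      using r unfolding y01 by simp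
  qed
  have proj: "model_proj (pair_proj a b H) \<in> N" if "H \<in> l2" for H
  proof (rule reducing_projI[OF N pair_proj_l2[OF that]])
    show "model_proj (lin (fps_nth (pair_proj a b H) (2 * k)) (fps_nth (pair_proj a b H) (Suc (2 * k)))) \<in> N" for k
      using lin by (simp add: pair_proj_nth mult.commute[of a] mult.commute[of b])
  qed
  have "\<exists>g\<in>l2. pair_proj a b (m * h) = m * g" if h: "h \<in> l2" for h
  proof
    let ?x = "pair_proj a b (m * h)"
    have x: "?x \<in> l2" and px: "model_proj ?x \<in> model" "model_proj ?x \<in> l2"
      using h by auto
    \<comment> \<open>Write P for the pair projection, Q for \<open>model_proj\<close> and x for P(m
      h). Then <Qx, Qx> = <x, Qx> = <m h, PQx> = <m h, Qx> = 0, because Qx lies in \<open>N\<close>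
      and hence is fixed by P.\<close>
    have "l2_inner (model_proj ?x) (model_proj ?x) = l2_inner ?x (model_proj ?x)"
      using x px(1) by (rule inner_model_proj_left)
    also have "\<dots> = l2_inner (m * h) (pair_proj a b (model_proj ?x))"
      using px h by (intro pair_proj_selfadjoint) auto
    also have "\<dots> = l2_inner (m * h) (model_proj ?x)"
      using fixN proj h m_mult_l2 by simp
    also have "\<dots> = 0"
      using px h by (intro inner_m_mult_model)
    finally have "model_proj ?x = 0"
      using px l2_inner_self_eq_0_iff by blast
    then show "?x = m * m_adj ?x"
      by (simp add: model_proj_def)
    show "m_adj ?x \<in> l2"
      using x by auto
  qed
  then show thesis
    using that unit_pair_axioms by blast
qed

text \<open>The subspace is the fixed space of the pair projection inside \<open>model\<close>. The
  element \<open>x\<close> with zero constant term guarantees that it is neither zero nor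
  everything.\<close>

theorem pair_proj_invariant_imp_reducing:
  assumes "unit_pair a b" and inv: "\<And>h. h \<in> l2 \<Longrightarrow> \<exists>g\<in>l2. pair_proj a b (m * h) = m * g"
    and x: "x \<in> model" "x \<noteq> 0" "fps_nth x 0 = 0"
  shows "\<exists>N. reducing N \<and> N \<noteq> {0} \<and> N \<noteq> model"
proof -
  interpret unit_pair a b by fact
  define N where "N = {F \<in> model. pair_proj a b F = F}"
  \<comment> \<open>The pair projection is self-adjoint, so invariance of the multiples of
    \<open>m\<close> passes to their orthogonal complement.\<close>
  have proj_model: "pair_proj a b F \<in> model" if "F \<in> model" for F
  proof -
    have F: "F \<in> l2" using that by (rule model_l2)
    have "l2_inner (pair_proj a b F) (m * h) = 0" if "h \<in> l2" for h
    proof -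
      obtain g where "g \<in> l2" "pair_proj a b (m * h) = m * g"
        using inv \<open>h \<in> l2\<close> by blast
      then show ?thesis
        using pair_proj_selfadjoint[of F "m * h"] F \<open>F \<in> model\<close> that
        by (simp add: inner_model_m_mult m_mult_l2)
    qed
    then show ?thesis
      using F by (auto simp: model_def)
  qed
  \<comment> \<open>The difference of the two sides is a multiple of \<open>m\<close> lying in
    \<open>model\<close>, hence zero.\<close>
  have comm: "pair_proj a b (model_proj F) = model_proj (pair_proj a b F)" if F: "F \<in> l2" for F
  proof -
    obtain g where g: "g \<in> l2" "pair_proj a b (m * m_adj F) = m * g"
      using inv m_adj_l2[OF F] by blast
    have PF: "pair_proj a b F \<in> l2" using F by auto
    let ?h = "m_adj (pair_proj a b F) - g"
    have eq: "pair_proj a b (model_proj F) - model_proj (pair_proj a b F) = m * ?h"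
      using g by (simp add: model_proj_def pair_proj_diff right_diff_distrib)
    have "pair_proj a b (model_proj F) - model_proj (pair_proj a b F) \<in> model"
      using F PF proj_model by auto
    then have "m * ?h = 0"
      using model_inter_m_mult[of ?h] g PF unfolding eq by auto
    then show ?thesis by (metis eq right_minus_eq)
  qed
  have "reducing N"
    unfolding reducing_def
  proof (intro conjI allI ballI impI; (elim conjE)?)
    show "N \<subseteq> model" "0 \<in> N"
      by (auto simp: N_def)
    show "F + G \<in> N" if "F \<in> N" "G \<in> N" for F G
      using that by (auto simp: N_def pair_proj_add)
    show "fps_const c * F \<in> N" if "F \<in> N" for c F
      using that by (auto simp: N_def pair_proj_cmult)
    show "fps_shift 2 F \<in> N" if "F \<in> N" for F
      using that by (auto simp: N_def pair_proj_shift2)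
    show "model_proj (fps_X\<^sup>2 * F) \<in> N" if "F \<in> N" for F
    proof -
      have F: "fps_X\<^sup>2 * F \<in> l2" "pair_proj a b F = F"
        using that by (auto simp: N_def dest: model_l2)
      then show ?thesis
        by (auto simp: N_def comm pair_proj_X2_mult)
    qed
    show "F \<in> N" if s: "\<forall>n. s n \<in> N" and F: "F \<in> l2"
      and lim: "(\<lambda>n. l2_normsq (s n - F)) \<longlonglongrightarrow> 0" for s F
    proof -
      have sm: "s n \<in> model" "s n \<in> l2" "pair_proj a b (s n) = s n" for n
        using s by (auto simp: N_def model_l2)
      have Fm: "F \<in> model"
        using sm F lim by (rule_tac model_closed)
      have PF: "pair_proj a b F \<in> l2"
        using F by auto
      \<comment> \<open>\<open>?D\<close> is orthogonal to every fixed \<open>s n\<close>, hence to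
        the limit \<open>F\<close>, and also to \<open>pair_proj a b F\<close>; so it is orthogonal
        to itself.\<close>
      let ?D = "F - pair_proj a b F"
      have D: "?D \<in> l2"
        using F PF by auto
      have "l2_inner (s n) ?D = 0" for n
        using pair_proj_selfadjoint[OF sm(2) D, of n] sm(3)[of n]
        by (simp add: pair_proj_diff pair_proj_idem)
      moreover have "(\<lambda>n. l2_inner (s n) ?D) \<longlonglongrightarrow> l2_inner F ?D"
        using lim sm(2) F D by (rule l2_inner_tendsto_left)
      ultimately have "l2_inner F ?D = 0"
        by (simp add: LIMSEQ_const_iff)
      moreover have "l2_inner (pair_proj a b F) ?D = 0"
        using pair_proj_selfadjoint[OF F D] by (simp add: pair_proj_diff pair_proj_idem)
      ultimately have "l2_inner ?D ?D = 0"
        using F PF D by (simp add: l2_inner_diff_left)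
      then have "?D = 0"
        using D l2_inner_self_eq_0_iff by blast
      then show ?thesis
        using Fm by (simp add: N_def)
    qed
  qed
  moreover have x_shift: "x = fps_X * fps_shift 1 x"
    using x(3) by (simp add: fps_eq_iff)
  \<comment> \<open>Both \<open>x\<close> and \<open>fps_shift 1 x\<close> lie in
    \<open>model\<close>. If both were fixed, cancelling \<open>lin c d\<close> in
    \<open>x = fps_X * fps_shift 1 x\<close> would make an even series equal to \<open>fps_X\<close>
    times an even one, forcing \<open>x = 0\<close>.\<close>
  have not_all: "\<not> (\<forall>F\<in>model. pair_proj c d F = F)" if "unit_pair c d" for c d
  proof
    interpret cd: unit_pair c d by fact
    assume all: "\<forall>F\<in>model. pair_proj c d F = F"
    have "lin c d * pair_coeff c d x = fps_X * (lin c d * pair_coeff c d (fps_shift 1 x))"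
      using all x(1) x_shift model_shift[OF x(1), of 1] unfolding pair_proj_def[symmetric] by simp
    then have *: "pair_coeff c d x = fps_X * pair_coeff c d (fps_shift 1 x)"
      using cd.lin_nonzero by (simp add: mult.left_commute)
    have "pair_coeff c d x = 0"
      by (rule even_X_mult_even_eq_0[OF _ _ *]) auto
    then have "pair_proj c d x = 0"
      by (simp add: pair_proj_def)
    then show False
      using all x by auto
  qed
  have "N \<noteq> model"
    using not_all[OF unit_pair_axioms] by (auto simp: N_def)
  moreover have "N \<noteq> {0}"
  proof
    assume N0: "N = {0}"
    have "pair_proj a b F = 0" if "F \<in> model" for F
    proof -
      have "pair_proj a b F \<in> N"
        using that by (simp add: N_def proj_model pair_proj_idem)
      then show ?thesis using N0 by simp
    qed
    \<comment> \<open>If the projection vanishes on \<open>model\<close>, the complementary one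
      fixes all of it, which \<open>not_all\<close> excludes as well.\<close>
    then show False
      using not_all[OF unit_pair_perp] by (simp add: pair_proj_perp)
  qed
  ultimately show ?thesis
    by blast
qed

end

section \<open>Even factors\<close>

text \<open>Substitution of \<open>- z\<close> for \<open>z\<close>, on coefficients.\<close>

definition flip :: "complex fps \<Rightarrow> complex fps" where
  "flip F = Abs_fps (\<lambda>n. (- 1) ^ n * fps_nth F n)"

lemma flip_nth [simp]: "fps_nth (flip F) n = (- 1) ^ n * fps_nth F n"
  by (simp add: flip_def)

lemma flip_mult: "flip (F * G) = flip F * flip G"
proof (rule fps_ext)
  fix n
  have "(- 1) ^ n * (fps_nth F i * fps_nth G (n - i))
      = (- 1) ^ i * fps_nth F i * ((- 1) ^ (n - i) * fps_nth G (n - i))" if "i \<le> n" for i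
  proof -
    have "(- 1 :: complex) ^ n = (- 1) ^ i * (- 1) ^ (n - i)"
      using that by (simp flip: power_add)
    then show ?thesis by simp
  qed
  then show "fps_nth (flip (F * G)) n = fps_nth (flip F * flip G) n"
    unfolding flip_nth fps_mult_nth sum_distrib_left by (intro sum.cong) auto
qed

lemma flip_lin: "flip (lin a b) = lin a (- b)"
  by (rule fps_ext) (auto simp: lin_nth)

lemma flip_one: "flip 1 = 1"
  by (rule fps_ext) simp

lemma flip_eq_0_iff: "flip F = 0 \<longleftrightarrow> F = 0"
  by (simp add: fps_eq_iff)

lemma even_fps_iff_flip: "even_fps F \<longleftrightarrow> flip F = F"
proof -
  have "(- 1) ^ n * c = c \<longleftrightarrow> (odd n \<longrightarrow> c = 0)" for n and c :: complex
    by (cases "even n") auto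
  then show ?thesis
    by (simp add: even_fps_def fps_eq_iff)
qed

lemma even_fps_mult: "even_fps F \<Longrightarrow> even_fps G \<Longrightarrow> even_fps (F * G)"
  by (simp add: even_fps_iff_flip flip_mult)

lemma even_fps_const [simp]: "even_fps (fps_const c)"
  by (simp add: even_fps_def)

text \<open>Flipping \<open>F * inverse F = 1\<close> exhibits \<open>flip (inverse F)\<close> as
  another inverse of \<open>F\<close>.\<close>

lemma even_fps_inverse:
  assumes "even_fps F" "fps_nth F 0 \<noteq> 0"
  shows "even_fps (inverse F)"
proof -
  have "F * inverse F = 1"
    using assms(2) by (rule inverse_mult_eq_1')
  moreover from this have "F * flip (inverse F) = 1"
    using assms(1) flip_mult[of F "inverse F"] by (simp add: flip_one even_fps_iff_flip)
  ultimately show ?thesis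
    using assms(2) unfolding even_fps_iff_flip by (metis fps_nonzero_nth mult_left_cancel)
qed

lemma l2_pair_coeff [intro]:
  assumes "F \<in> l2"
  shows "pair_coeff a b F \<in> l2"
proof -
  \<comment> \<open>At even indices \<open>pair_coeff a b F\<close> has the coefficients of
    \<open>?G\<close>; elsewhere it is zero.\<close>
  let ?G = "fps_const (cnj a) * F + fps_const (cnj b) * fps_shift 1 F"
  have "?G \<in> l2"
    using assms by auto
  then have "summable (\<lambda>n. (cmod (fps_nth (pair_coeff a b F) n))\<^sup>2)"
    by (rule summable_comparison_test'[OF l2D]) (simp add: pair_coeff_def mult.commute)
  then show ?thesis
    by (simp add: l2_def)
qed

lemma lin_scale: "lin (c * a) (c * b) = fps_const c * lin a b"
  by (rule fps_ext) (auto simp: lin_nth)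

section \<open>Invariant pair projections and factorizations of the multiplier\<close>

context isometric_multiplier
begin

lemma m_nonzero: "m \<noteq> 0"
  using inner_mX_m[of 0] by auto

text \<open>The parity argument again, applied to \<open>m\<close> and \<open>m * fps_X\<close>
  after cancelling \<open>lin a b\<close>.\<close>

lemma pair_proj_not_fix_m:
  assumes "unit_pair a b" "pair_proj a b m = m" "pair_proj a b (m * fps_X) = m * fps_X"
  shows False
proof -
  interpret unit_pair a b by fact
  have "lin a b * pair_coeff a b (m * fps_X) = fps_X * (lin a b * pair_coeff a b m)"
    using assms(2,3) unfolding pair_proj_def[symmetric] by (simp add: mult.commute)
  then have *: "pair_coeff a b (m * fps_X) = fps_X * pair_coeff a b m"
    using lin_nonzero by (simp add: mult.left_commute)
  have "pair_coeff a b (m * fps_X) = 0"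
    by (rule even_X_mult_even_eq_0[OF _ _ *]) auto
  then show False
    using assms(3) m_nonzero by (simp add: pair_proj_def)
qed

text \<open>The series \<open>g k\<close> are the values at \<open>fps_X ^ k\<close> of the
  projection pulled back along \<open>m\<close>. Those for \<open>k < 2\<close> are linear
  polynomials: a nonzero one among \<open>g 0\<close>, \<open>g 1\<close> gives the direction
  \<open>(a', b')\<close>, and a nonzero \<open>fps_X ^ j - g j\<close> gives the orthogonal
  direction.\<close>

lemma pair_proj_invariant_imp_factor:
  assumes "unit_pair a b" and inv: "\<And>h. h \<in> l2 \<Longrightarrow> \<exists>g\<in>l2. pair_proj a b (m * h) = m * g"
  obtains a' b' u v where "unit_pair a' b'" "even_fps u" "even_fps v" "u \<in> l2" "v \<in> l2"
    "m * lin a' b' = lin a b * u" "m * lin (- cnj b') (cnj a') = lin (- cnj b) (cnj a) * v"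
proof -
  interpret unit_pair a b by fact
  interpret perp: unit_pair "- cnj b" "cnj a" by (rule unit_pair_perp)
  have "\<forall>k. \<exists>g\<in>l2. pair_proj a b (m * fps_X ^ k) = m * g"
    using inv by auto
  then obtain g where gl2: "\<And>k. g k \<in> l2" and g: "\<And>k. pair_proj a b (m * fps_X ^ k) = m * g k"
    by metis
  \<comment> \<open>Self-adjointness and commutation with \<open>fps_X\<^sup>2\<close> turn this
    coefficient into the conjugate of coefficient \<open>i\<close> of
    \<open>fps_X\<^sup>2 * g n\<close>, which is zero because \<open>i < 2\<close>.\<close>
  have g_high: "fps_nth (g i) (n + 2) = 0" if "i < 2" for i n
  proof -
    have "fps_nth (g i) (n + 2) = l2_inner (m * g i) (m * fps_X ^ (n + 2))"
      by (rule inner_m_mult_mX[OF gl2, symmetric])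
    also have "\<dots> = l2_inner (m * fps_X ^ i) (pair_proj a b (m * fps_X ^ (n + 2)))"
      unfolding g[symmetric] by (rule pair_proj_selfadjoint) auto
    also have "m * fps_X ^ (n + 2) = fps_X\<^sup>2 * (m * fps_X ^ n)"
      by (simp only: power_add mult_ac)
    also have "pair_proj a b (fps_X\<^sup>2 * (m * fps_X ^ n)) = m * (fps_X\<^sup>2 * g n)"
      unfolding pair_proj_X2_mult g by (simp only: mult.left_commute)
    also have "l2_inner (m * fps_X ^ i) (m * (fps_X\<^sup>2 * g n)) = cnj (fps_nth (fps_X\<^sup>2 * g n) i)"
      using gl2 l2_inner_commute[of "m * fps_X ^ i" "m * (fps_X\<^sup>2 * g n)"]
      by (simp add: inner_m_mult_mX m_mult_l2 l2_X_power_mult)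
    also have "\<dots> = 0"
      using that by (simp add: fps_X_power_mult_nth)
    finally show ?thesis .
  qed
  have lin_eq: "F = lin (fps_nth F 0) (fps_nth F 1)" if "\<And>n. fps_nth F (n + 2) = 0" for F
  proof (rule fps_ext)
    fix n :: nat
    consider "n = 0" | "n = 1" | k where "n = k + 2"
      by (metis One_nat_def add.commute le_Suc_ex less_2_cases not_le)
    then show "fps_nth F n = fps_nth (lin (fps_nth F 0) (fps_nth F 1)) n"
      using that by cases (simp_all add: lin_nth del: One_nat_def add_2_eq_Suc')
  qed
  \<comment> \<open>Otherwise the projection kills \<open>m\<close> and \<open>m * fps_X\<close>, so
    the complementary one fixes both.\<close>
  have "g 0 \<noteq> 0 \<or> g 1 \<noteq> 0"
  proof (rule ccontr)
    assume "\<not> ?thesis"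
    then have "pair_proj a b m = 0" "pair_proj a b (m * fps_X) = 0"
      using g[of 0] g[of 1] by simp_all
    then show False
      using pair_proj_not_fix_m[OF unit_pair_perp] by (simp add: pair_proj_perp)
  qed
  then obtain i where i: "i < 2" "g i \<noteq> 0"
    by (metis one_less_numeral_iff pos2 semiring_norm(76))
  have "1 - g 0 \<noteq> 0 \<or> fps_X - g 1 \<noteq> 0"
  proof (rule ccontr)
    assume "\<not> ?thesis"
    then have "pair_proj a b m = m" "pair_proj a b (m * fps_X) = m * fps_X"
      using g[of 0] g[of 1] by simp_all
    then show False
      using pair_proj_not_fix_m[OF unit_pair_axioms] by simp
  qed
  then obtain j where j: "j < 2" "fps_X ^ j - g j \<noteq> 0"
    by (metis one_less_numeral_iff pos2 power_0 power_one_right semiring_norm(76))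
  define x y where "x = fps_nth (g i) 0" and "y = fps_nth (g i) 1"
  define z w where "z = fps_nth (fps_X ^ j - g j) 0" and "w = fps_nth (fps_X ^ j - g j) 1"
  have e': "g i = lin x y"
    unfolding x_def y_def using i(1) by (intro lin_eq g_high)
  have f': "fps_X ^ j - g j = lin z w"
    unfolding z_def w_def using j(1) g_high[of j] by (intro lin_eq) auto
  have me': "m * lin x y = pair_proj a b (m * fps_X ^ i)"
    by (simp add: g flip: e')
  have mf': "m * lin z w = pair_proj (- cnj b) (cnj a) (m * fps_X ^ j)"
    by (simp add: g pair_proj_perp right_diff_distrib flip: f')
  \<comment> \<open>\<open>m * lin x y\<close> lies in the range of the projection and
    \<open>m * lin z w\<close> in its kernel. As \<open>m\<close> preserves inner products, the
    coefficient vectors are orthogonal as well.\<close>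
  have orth: "x * cnj z + y * cnj w = 0"
  proof -
    have "l2_inner (m * lin x y) (m * lin z w)
        = l2_inner (m * fps_X ^ i) (pair_proj a b (m * lin z w))"
      unfolding me' by (rule pair_proj_selfadjoint) (auto simp: mf')
    also have "pair_proj a b (m * lin z w) = 0"
      unfolding mf' by (simp add: pair_proj_perp pair_proj_diff pair_proj_idem)
    finally have "l2_inner (m * lin x y) (m * lin z w) = 0"
      by simp
    moreover have "m * lin z w = fps_const z * (m * fps_X ^ 0) + fps_const w * (m * fps_X ^ 1)"
      by (simp add: lin_def algebra_simps)
    ultimately have "cnj z * fps_nth (lin x y) 0 + cnj w * fps_nth (lin x y) 1 = 0"
      using inner_m_mult_mX[of "lin x y"]
      by (simp only: l2_inner_add_right l2_inner_cmult_right l2_cmult mX_l2 m_mult_l2 lin_l2)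
    then show ?thesis
      by (simp add: lin_nth algebra_simps)
  qed
  have "x \<noteq> 0 \<or> y \<noteq> 0"
    using i(2) unfolding e' lin_eq_0_iff by blast
  then obtain r a' b' where r: "r > 0" and "unit_pair a' b'"
    and xy: "x = of_real r * a'" "y = of_real r * b'"
    using unit_pair_normalize by blast
  interpret ab': unit_pair a' b' by fact
  have orth': "a' * cnj z + b' * cnj w = 0"
    using orth r unfolding xy mult.assoc distrib_left[symmetric] by simp
  have "w * cnj b' + z * cnj a' = cnj (a' * cnj z + b' * cnj w)"
    by (simp add: algebra_simps)
  then have orth'': "w * cnj b' = - (z * cnj a')"
    unfolding orth' by (simp add: eq_neg_iff_add_eq_0)
  \<comment> \<open>The orthogonal complement of \<open>(a', b')\<close> in C^2 is spanned by the
    unit vector \<open>(- cnj b', cnj a')\<close>, and \<open>t\<close> is the component of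
    \<open>(z, w)\<close> along it.\<close>
  define t where "t = w * a' - z * b'"
  have z: "z = t * (- cnj b')"
  proof -
    have "t * (- cnj b') = z * (b' * cnj b') - a' * (w * cnj b')"
      by (simp add: t_def algebra_simps)
    also have "\<dots> = z * (a' * cnj a' + b' * cnj b')"
      unfolding orth'' by (simp add: algebra_simps)
    finally show ?thesis using ab'.unit by simp
  qed
  have w: "w = t * cnj a'"
  proof -
    have "t * cnj a' = w * (a' * cnj a') - b' * (z * cnj a')"
      by (simp add: t_def algebra_simps)
    also have "z * cnj a' = - (w * cnj b')"
      using orth'' by simp
    also have "w * (a' * cnj a') - b' * - (w * cnj b') = w * (a' * cnj a' + b' * cnj b')"
      by (simp add: algebra_simps)
    finally show ?thesis using ab'.unit by simp
  qed
  have t: "t \<noteq> 0"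
    using j(2) z w unfolding f' lin_eq_0_iff by auto
  \<comment> \<open>\<open>pair_coeff\<close> supplies even series; the constants undo the scaling
    by \<open>r\<close> and by \<open>t\<close>.\<close>
  define u where "u = fps_const (1 / of_real r) * pair_coeff a b (m * fps_X ^ i)"
  define v where "v = fps_const (1 / t) * pair_coeff (- cnj b) (cnj a) (m * fps_X ^ j)"
  have uv: "even_fps u" "even_fps v" "u \<in> l2" "v \<in> l2"
    unfolding u_def v_def by (auto intro: even_fps_mult)
  have "fps_const (of_real r) * (m * lin a' b') = fps_const (of_real r) * (lin a b * u)"
    using me' r unfolding xy lin_scale pair_proj_def u_def
    by (simp add: mult.left_commute flip: mult.assoc fps_const_mult)
  then have eq1: "m * lin a' b' = lin a b * u"
    using r by simp
  have "fps_const t * (m * lin (- cnj b') (cnj a')) = fps_const t * (lin (- cnj b) (cnj a) * v)"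
    using mf' t unfolding z w lin_scale pair_proj_def v_def
    by (simp add: mult.left_commute)
  then have eq2: "m * lin (- cnj b') (cnj a') = lin (- cnj b) (cnj a) * v"
    using t by simp
  show thesis
    using that[OF \<open>unit_pair a' b'\<close> uv eq1 eq2] .
qed

text \<open>Split \<open>h\<close> along \<open>(a', b')\<close> and its complement. The two
  identities carry the pieces into the range of \<open>pair_proj a b\<close> and into its
  complement, so the witness is \<open>pair_proj a' b' h\<close>.\<close>

lemma factor_imp_pair_proj_invariant:
  assumes "unit_pair a b" "unit_pair a' b'" "even_fps u" "even_fps v"
    "m * lin a' b' = lin a b * u" "m * lin (- cnj b') (cnj a') = lin (- cnj b) (cnj a) * v"
    and h: "h \<in> l2"
  shows "\<exists>g\<in>l2. pair_proj a b (m * h) = m * g"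
proof
  interpret unit_pair a b by fact
  interpret ab': unit_pair a' b' by fact
  interpret perp: unit_pair "- cnj b" "cnj a" by (rule unit_pair_perp)
  let ?p = "pair_coeff a' b' h" and ?q = "pair_coeff (- cnj b') (cnj a') h"
  have hp: "h = lin a' b' * ?p + lin (- cnj b') (cnj a') * ?q"
    using ab'.pair_proj_perp[of h] unfolding pair_proj_def by (simp add: algebra_simps)
  have "m * h = m * lin a' b' * ?p + m * lin (- cnj b') (cnj a') * ?q"
    by (subst hp) (simp add: distrib_left mult.assoc)
  then have "m * h = lin a b * (u * ?p) + lin (- cnj b) (cnj a) * (v * ?q)"
    unfolding assms(5,6) by (simp add: mult.assoc)
  moreover have "pair_proj a b (lin a b * (u * ?p)) = lin a b * (u * ?p)"
    by (intro pair_proj_lin_mult even_fps_mult assms even_pair_coeff)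
  moreover have "pair_proj (- cnj b) (cnj a) (lin (- cnj b) (cnj a) * (v * ?q)) = lin (- cnj b) (cnj a) * (v * ?q)"
    by (intro perp.pair_proj_lin_mult even_fps_mult assms even_pair_coeff)
  ultimately have "pair_proj a b (m * h) = lin a b * (u * ?p)"
    by (simp add: pair_proj_add pair_proj_perp)
  also have "\<dots> = m * pair_proj a' b' h"
    using assms(5) by (simp add: pair_proj_def flip: mult.assoc)
  finally show "pair_proj a b (m * h) = m * pair_proj a' b' h" .
  show "pair_proj a' b' h \<in> l2"
    using h by auto
qed

lemma even_imp_pair_proj_invariant:
  assumes "even_fps m" "h \<in> l2"
  shows "\<exists>g\<in>l2. pair_proj 1 0 (m * h) = m * g"
  by (rule factor_imp_pair_proj_invariant[of _ _ 1 0 m m])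
     (use assms in \<open>auto simp: unit_pair_def\<close>)

text \<open>Normalizing \<open>(\<mu>, 1)\<close> gives \<open>(a, b)\<close> with \<open>b\<close>
  real, and \<open>(b, cnj a)\<close> serves as the second pair. The given identity is then one of
  the two required factorizations; the complementary one has to be built.\<close>

lemma Blaschke_imp_pair_proj_invariant:
  assumes "even_fps p" "m * lin 1 (cnj \<mu>) = lin \<mu> 1 * p"
  obtains a b where "unit_pair a b" "\<And>h. h \<in> l2 \<Longrightarrow> \<exists>g\<in>l2. pair_proj a b (m * h) = m * g"
proof -
  obtain r a b where r: "r > 0" and ab: "unit_pair a b" and eq: "\<mu> = of_real r * a" "1 = of_real r * b"
    using unit_pair_normalize[of \<mu> 1] by auto
  have cnj_b: "cnj b = b"
  proof -
    have "b = of_real (1 / r)" using eq(2) r by (simp add: field_simps)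
    then show ?thesis by simp
  qed
  have ab': "unit_pair b (cnj a)"
    using ab unfolding unit_pair_def cnj_b by (simp add: algebra_simps)
  have b: "b \<noteq> 0" using eq(2) by auto
  have "fps_const (of_real r) * (m * lin b (cnj a)) = fps_const (of_real r) * (lin a b * p)"
  proof -
    have "lin 1 (cnj \<mu>) = fps_const (of_real r) * lin b (cnj a)" "lin \<mu> 1 = fps_const (of_real r) * lin a b"
      unfolding lin_scale[symmetric] eq(2)[symmetric] eq(1) by simp_all
    then show ?thesis
      using assms(2) by (simp add: mult.assoc mult.left_commute)
  qed
  then have 1: "m * lin b (cnj a) = lin a b * p"
    using r by simp
  \<comment> \<open>\<open>A\<close> and \<open>B\<close> are even, being products of a linear
    factor with its reflection up to sign. Multiplying the first identity by
    \<open>lin (- a) b\<close> and cancelling \<open>lin b (cnj a)\<close> gives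
    \<open>p * A / B\<close> as the missing even factor.\<close>
  define A where "A = fps_const (b\<^sup>2) * fps_X\<^sup>2 - fps_const (a\<^sup>2)"
  define B where "B = fps_const ((cnj a)\<^sup>2) * fps_X\<^sup>2 - fps_const (b\<^sup>2)"
  have A: "lin a b * lin (- a) b = A" and B: "lin b (cnj a) * lin (- b) (cnj a) = B"
    unfolding A_def B_def lin_def
    by (simp_all add: algebra_simps power2_eq_square flip: fps_const_mult fps_const_neg)
  have evens: "even_fps A" "even_fps B"
    by (auto simp: even_fps_def A_def B_def elim!: oddE)
  \<comment> \<open>The constant term \<open>- b\<^sup>2\<close> makes \<open>B\<close> invertible
    as a power series.\<close>
  have B0: "fps_nth B 0 \<noteq> 0"
    using b by (simp add: B_def)
  define v where "v = p * A * inverse B"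
  have "lin b (cnj a) * (m * lin (- a) b) = p * A"
    using 1 A by (metis mult.assoc mult.commute)
  also have "\<dots> = p * A * (inverse B * B)"
    using inverse_mult_eq_1[OF B0] by simp
  also have "\<dots> = lin b (cnj a) * (lin (- b) (cnj a) * v)"
    unfolding v_def B[symmetric] by (simp only: mult_ac)
  finally have 2: "m * lin (- a) b = lin (- b) (cnj a) * v"
    using b by (simp add: lin_eq_0_iff)
  have "even_fps v"
    unfolding v_def using evens B0 assms(1) by (intro even_fps_mult even_fps_inverse)
  then show thesis
    using that[OF ab] factor_imp_pair_proj_invariant[OF ab ab' assms(1) _ 1, of v] 2
    by (simp add: cnj_b)
qed

end

text \<open>Sum and product of the squared moduli agree for both pairs, so these moduli agree up to
  order. In the same order the pairs are parallel; in the swapped order \<open>(a', b')\<close> is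
  parallel to \<open>(cnj b, cnj a)\<close>. Keeping \<open>cmod a \<noteq> cmod b\<close> in the
  second alternative later puts the Blaschke parameter inside the disc.\<close>

lemma unit_pair_factor_cases:
  assumes "unit_pair a b" "unit_pair a' b'" "a * cnj b = a' * cnj b'"
  obtains "b' * a = a' * b" | t where "t \<noteq> 0" "cmod a \<noteq> cmod b" "a' = t * cnj b" "b' = t * cnj a"
proof -
  interpret unit_pair a b by fact
  interpret ab': unit_pair a' b' by fact
  define A B A' B' where "A = (cmod a)\<^sup>2" and "B = (cmod b)\<^sup>2" and "A' = (cmod a')\<^sup>2" and "B' = (cmod b')\<^sup>2"
  note defs = A_def B_def A'_def B'_def
  have B: "B = 1 - A" and B': "B' = 1 - A'"
    using norm_unit ab'.norm_unit by (simp_all add: defs)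
  have AB: "A * B = A' * B'"
    using arg_cong[OF assms(3), of "\<lambda>z. (cmod z)\<^sup>2"] by (simp add: defs norm_mult power_mult_distrib)
  have "(A' - A) * (A' - B) = 0"
    using AB unfolding B B' by (simp add: algebra_simps)
  then consider "A' = A" | "A' \<noteq> A" "A' = B"
    by auto
  then show thesis
  proof cases
    case 1
    \<comment> \<open>The determinant of the two pairs: the hypothesis turns the mixed terms of its
      squared modulus into \<open>2 * (A * B)\<close>, and \<open>A' = A\<close> makes the total
      vanish.\<close>
    have "of_real ((cmod (b' * a - a' * b))\<^sup>2) = (b' * a - a' * b) * cnj (b' * a - a' * b)"
      by (rule complex_norm_square)
    also have "\<dots> = (b' * cnj b') * (a * cnj a) + (a' * cnj a') * (b * cnj b)
        - (a * cnj b) * cnj (a' * cnj b') - (a' * cnj b') * cnj (a * cnj b)"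
      by (simp add: algebra_simps)
    also have "\<dots> = (b' * cnj b') * (a * cnj a) + (a' * cnj a') * (b * cnj b)
        - 2 * ((a * cnj a) * (b * cnj b))"
      unfolding assms(3)[symmetric] by (simp add: algebra_simps)
    also have "\<dots> = of_real (B' * A + A' * B - 2 * (A * B))"
      unfolding defs of_real_diff of_real_add of_real_mult complex_norm_square by simp
    also have "\<dots> = 0"
      using 1 AB B B' by simp
    finally have "b' * a = a' * b"
      by simp
    then show thesis by (rule that(1))
  next
    case 2
    \<comment> \<open>The same computation for the determinant of \<open>(a', b')\<close> and
      \<open>(cnj b, cnj a)\<close>.\<close>
    have "of_real ((cmod (a' * cnj a - b' * cnj b))\<^sup>2) = (a' * cnj a - b' * cnj b) * cnj (a' * cnj a - b' * cnj b)"
      by (rule complex_norm_square)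
    also have "\<dots> = (a' * cnj a') * (a * cnj a) + (b' * cnj b') * (b * cnj b)
        - (a' * cnj b') * cnj (a * cnj b) - (a * cnj b) * cnj (a' * cnj b')"
      by (simp add: algebra_simps)
    also have "\<dots> = (a' * cnj a') * (a * cnj a) + (b' * cnj b') * (b * cnj b)
        - 2 * ((a * cnj a) * (b * cnj b))"
      unfolding assms(3)[symmetric] by (simp add: algebra_simps)
    also have "\<dots> = of_real (A' * A + B' * B - 2 * (A * B))"
      unfolding defs of_real_diff of_real_add of_real_mult complex_norm_square by simp
    also have "\<dots> = 0"
      using 2 B B' by simp
    finally have *: "a' * cnj a = b' * cnj b"
      by simp
    \<comment> \<open>The inner product of \<open>(a', b')\<close> with the unit vector
      \<open>(cnj b, cnj a)\<close>, hence the proportionality factor.\<close>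
    define t where "t = a' * b + b' * a"
    have "t * cnj b = a' * (b * cnj b) + a * (b' * cnj b)"
      by (simp add: t_def algebra_simps)
    also have "\<dots> = a' * (a * cnj a + b * cnj b)"
      unfolding *[symmetric] by (simp add: algebra_simps)
    finally have ta: "a' = t * cnj b"
      using unit by simp
    have "t * cnj a = b * (a' * cnj a) + b' * (a * cnj a)"
      by (simp add: t_def algebra_simps)
    also have "\<dots> = b' * (a * cnj a + b * cnj b)"
      unfolding * by (simp add: algebra_simps)
    finally have tb: "b' = t * cnj a"
      using unit by simp
    have "t \<noteq> 0"
      using ta tb ab'.unit by auto
    moreover have "cmod a \<noteq> cmod b"
      using 2 by (auto simp: defs)
    ultimately show thesis
      using ta tb by (rule that(2))
  qed
qed

section \<open>Elimination: an even multiplier or a Blaschke factor\<close>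

context isometric_multiplier
begin

lemma pair_proj_invariant_imp_even_or_Blaschke:
  assumes "unit_pair a b" "\<And>h. h \<in> l2 \<Longrightarrow> \<exists>g\<in>l2. pair_proj a b (m * h) = m * g"
  shows "even_fps m \<or> (\<exists>\<mu> p. cmod \<mu> < 1 \<and> even_fps p \<and> p \<in> l2 \<and> m * lin 1 (cnj \<mu>) = lin \<mu> 1 * p)"
proof -
  interpret unit_pair a b by fact
  obtain a' b' u v where "unit_pair a' b'" and uv: "even_fps u" "even_fps v" "u \<in> l2" "v \<in> l2"
    and mu: "m * lin a' b' = lin a b * u" and mv: "m * lin (- cnj b') (cnj a') = lin (- cnj b) (cnj a) * v"
    using pair_proj_invariant_imp_factor[OF assms] by blast
  interpret ab': unit_pair a' b' by fact
  \<comment> \<open>Cross-multiplication eliminates the common factor \<open>U\<close>. It is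
    applied to each factorization and its flipped version, which share an even factor.\<close>
  have cross: "M * (F * G') = M' * (F' * G)" if "M * F = G * U" "M' * F' = G' * U" for M M' F F' G G' U :: "complex fps"
  proof -
    have "M * (F * G') = G * U * G'"
      unfolding that(1)[symmetric] by (simp only: mult.assoc)
    also have "\<dots> = G' * U * G"
      by (simp only: mult_ac)
    also have "\<dots> = M' * (F' * G)"
      unfolding that(2)[symmetric] by (simp only: mult.assoc)
    finally show ?thesis .
  qed
  have "flip m * lin a' (- b') = lin a (- b) * u"
    using arg_cong[OF mu, of flip] uv by (simp add: flip_mult flip_lin even_fps_iff_flip)
  then have eq1: "m * (lin a' b' * lin a (- b)) = flip m * (lin a' (- b') * lin a b)"
    by (rule cross[OF mu])
  have "flip m * lin (- cnj b') (- cnj a') = lin (- cnj b) (- cnj a) * v"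
    using arg_cong[OF mv, of flip] uv by (simp add: flip_mult flip_lin even_fps_iff_flip)
  then have eq2: "m * (lin (- cnj b') (cnj a') * lin (- cnj b) (- cnj a))
      = flip m * (lin (- cnj b') (- cnj a') * lin (- cnj b) (cnj a))"
    by (rule cross[OF mv])
  let ?l = "lin a' b' * (lin a (- b) * (lin (- cnj b') (- cnj a') * lin (- cnj b) (cnj a)))"
  let ?r = "lin a' (- b') * (lin a b * (lin (- cnj b') (cnj a') * lin (- cnj b) (- cnj a)))"
  \<comment> \<open>Multiplying \<open>eq1\<close> by the reversed \<open>eq2\<close> allows
    \<open>m * flip m\<close> to be cancelled, leaving a polynomial identity in the two
    pairs.\<close>
  have "(m * flip m) * ?l
      = (m * (lin a' b' * lin a (- b))) * (flip m * (lin (- cnj b') (- cnj a') * lin (- cnj b) (cnj a)))"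
    by (simp only: mult_ac)
  also have "\<dots> = (m * flip m) * ?r"
    unfolding eq1 eq2[symmetric] by (simp only: mult_ac)
  finally have lr: "?l = ?r"
    using m_nonzero by (simp add: flip_eq_0_iff)
  \<comment> \<open>The coefficient of \<open>fps_X\<close> in that identity.\<close>
  have "2 * (a * cnj b * (a' * cnj a' + b' * cnj b')) = 2 * (a' * cnj b' * (a * cnj a + b * cnj b))"
    using arg_cong[OF lr, of "\<lambda>F. fps_nth F 1"] by (simp add: lin_mult_nth lin_nth algebra_simps)
  then have ab: "a * cnj b = a' * cnj b'"
    unfolding unit ab'.unit by simp
  show ?thesis
  proof (rule unit_pair_factor_cases[OF unit_pair_axioms ab'.unit_pair_axioms ab])
    assume d: "b' * a = a' * b"
    \<comment> \<open>For parallel pairs the two polynomial factors in \<open>eq1\<close> coincide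
      and cancel.\<close>
    have "lin a' b' * lin a (- b) = lin a' (- b') * lin a b"
    proof (rule fps_ext)
      fix n
      show "fps_nth (lin a' b' * lin a (- b)) n = fps_nth (lin a' (- b') * lin a b) n"
        using d by (auto simp: lin_mult_nth lin_nth algebra_simps)
    qed
    moreover have "lin a' b' * lin a (- b) \<noteq> 0"
      using lin_nonzero ab'.lin_nonzero by (simp add: lin_eq_0_iff)
    ultimately have "flip m = m"
      using eq1 by (simp flip: \<open>lin a' b' * lin a (- b) = lin a' (- b') * lin a b\<close>)
    then show ?thesis
      by (simp add: even_fps_iff_flip)
  next
    fix t assume t: "t \<noteq> 0" and neq: "cmod a \<noteq> cmod b" and a': "a' = t * cnj b" and b': "b' = t * cnj a"
    \<comment> \<open>\<open>\<mu>\<close> must have modulus below one: if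
      \<open>cmod a < cmod b\<close> the first factorization supplies \<open>a / b\<close>,
      otherwise the complementary one supplies \<open>- cnj b / cnj a\<close>.\<close>
    consider "cmod a < cmod b" | "cmod b < cmod a"
      using neq by linarith
    then show ?thesis
    proof cases
      case 1
      then have b0: "b \<noteq> 0" by auto
      define \<mu> p where "\<mu> = a / b" and "p = fps_const (b / (t * cnj b)) * u"
      have "lin a' b' = fps_const (t * cnj b) * lin 1 (cnj \<mu>)" "lin a b = fps_const b * lin \<mu> 1"
        unfolding lin_scale[symmetric] using b0 by (simp_all add: \<mu>_def a' b')
      then have "fps_const (t * cnj b) * (m * lin 1 (cnj \<mu>)) = fps_const b * (lin \<mu> 1 * u)"
        using mu by (simp only: mult_ac)
      also have "\<dots> = fps_const (t * cnj b) * (lin \<mu> 1 * p)"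
        using t b0 by (simp add: p_def mult.left_commute flip: mult.assoc)
      finally have "m * lin 1 (cnj \<mu>) = lin \<mu> 1 * p"
        using t b0 by simp
      moreover have "cmod \<mu> < 1"
        using 1 by (simp add: \<mu>_def norm_divide divide_less_eq)
      moreover have "even_fps p" "p \<in> l2"
        using uv by (auto simp: p_def intro: even_fps_mult)
      ultimately show ?thesis by blast
    next
      case 2
      then have a0: "a \<noteq> 0" by auto
      define \<mu> p where "\<mu> = - cnj b / cnj a" and "p = fps_const (cnj a / - (cnj t * a)) * v"
      have "lin (- cnj b') (cnj a') = fps_const (- (cnj t * a)) * lin 1 (cnj \<mu>)"
        "lin (- cnj b) (cnj a) = fps_const (cnj a) * lin \<mu> 1"
        unfolding lin_scale[symmetric] using a0 by (simp_all add: \<mu>_def a' b')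
      then have "fps_const (- (cnj t * a)) * (m * lin 1 (cnj \<mu>)) = fps_const (cnj a) * (lin \<mu> 1 * v)"
        using mv by (simp only: mult_ac)
      also have "\<dots> = fps_const (- (cnj t * a)) * (lin \<mu> 1 * p)"
        using t a0 by (simp add: p_def mult.left_commute del: fps_const_neg flip: mult.assoc)
      finally have "m * lin 1 (cnj \<mu>) = lin \<mu> 1 * p"
        using t a0 by (simp del: fps_const_neg)
      moreover have "cmod \<mu> < 1"
        using 2 by (simp add: \<mu>_def norm_divide divide_less_eq)
      moreover have "even_fps p" "p \<in> l2"
        using uv by (auto simp: p_def intro: even_fps_mult)
      ultimately show ?thesis by blast
    qed
  qed
qed

text \<open>For \<open>p\<close> convergence on the disc is recorded, the form that evaluation of
  functions there can translate.\<close>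

theorem exists_reducing_iff:
  assumes "x \<in> model" "x \<noteq> 0" "fps_nth x 0 = 0"
  shows "(\<exists>N. reducing N \<and> N \<noteq> {0} \<and> N \<noteq> model) \<longleftrightarrow>
    even_fps m \<or> (\<exists>\<mu> p. cmod \<mu> < 1 \<and> even_fps p \<and> fps_conv_radius p \<ge> 1
                        \<and> m * lin 1 (cnj \<mu>) = lin \<mu> 1 * p)"
    (is "?L \<longleftrightarrow> ?R")
proof
  assume ?L
  then obtain a b where "unit_pair a b" "\<And>h. h \<in> l2 \<Longrightarrow> \<exists>g\<in>l2. pair_proj a b (m * h) = m * g"
    using reducing_imp_pair_proj_invariant by metis
  then show ?R
    using pair_proj_invariant_imp_even_or_Blaschke l2_conv_radius by blast
next
  assume ?R
  then obtain a b where "unit_pair a b" "\<And>h. h \<in> l2 \<Longrightarrow> \<exists>g\<in>l2. pair_proj a b (m * h) = m * g"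
  proof (elim disjE exE conjE)
    assume "even_fps m"
    then show ?thesis
      using that[of 1 0] even_imp_pair_proj_invariant by (auto simp: unit_pair_def)
  next
    fix \<mu> p assume "even_fps p" "m * lin 1 (cnj \<mu>) = lin \<mu> 1 * p"
    then show ?thesis
      using that by (rule Blaschke_imp_pair_proj_invariant)
  qed
  then show ?L
    using assms by (rule pair_proj_invariant_imp_reducing)
qed

end

section \<open>Inner functions act isometrically\<close>

text \<open>For distinct exponents the antiderivative is periodic with period \<open>2 * pi\<close>,
  since their difference is an integer.\<close>

lemma has_bochner_integral_cis_power:
  "has_bochner_integral lborel
     (\<lambda>t. indicator {0..2 * pi} t *\<^sub>R (cis t ^ k * cnj (cis t ^ l))) (if k = l then 2 * pi else 0)"
proof -
  define c where "c = real k - real l"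
  have cis_eq: "cis t ^ k * cnj (cis t ^ l) = exp (\<i> * of_real c * of_real t)" for t
  proof -
    have "cis t ^ k * cnj (cis t ^ l) = cis (c * t)"
      by (simp add: Complex.DeMoivre cis_cnj cis_mult c_def left_diff_distrib)
    then show ?thesis
      by (simp add: cis_conv_exp mult.assoc)
  qed
  show ?thesis
  proof (cases "k = l")
    case True
    have "has_bochner_integral lborel (\<lambda>t. indicator {0..2 * pi} t *\<^sub>R (1 :: complex))
        (of_real (2 * pi) - of_real 0)"
    proof (rule has_bochner_integral_FTC_Icc)
      show "(of_real has_vector_derivative (1 :: complex)) (at t within {0..2 * pi})" for t
        by (auto intro!: derivative_eq_intros)
    qed auto
    then show ?thesis
      using True unfolding cis_eq by (simp add: c_def)
  next
    case False
    then have c: "c \<noteq> 0" by (simp add: c_def)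
    let ?E = "\<lambda>t::complex. exp (\<i> * of_real c * t) / (\<i> * of_real c)"
    have "has_bochner_integral lborel
        (\<lambda>t. indicator {0..2 * pi} t *\<^sub>R exp (\<i> * of_real c * complex_of_real t))
        (?E (of_real (2 * pi)) - ?E (of_real 0))"
    proof (rule has_bochner_integral_FTC_Icc)
      fix t
      show "((\<lambda>t. ?E (complex_of_real t)) has_vector_derivative exp (\<i> * of_real c * of_real t))
          (at t within {0..2 * pi})"
        by (rule has_vector_derivative_real_field) (use c in \<open>auto intro!: derivative_eq_intros\<close>)
    qed (auto intro!: continuous_intros)
    moreover have "exp (\<i> * of_real c * of_real (2 * pi)) = (1 :: complex)"
    proof -
      have "c \<in> \<int>"
        by (simp add: c_def)
      then show ?thesis
        using exp_integer_2pi[of c] by (simp add: mult_ac)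
    qed
    ultimately show ?thesis
      using False unfolding cis_eq by simp
  qed
qed

lemma integrable_indicator_Icc_const:
  "integrable lborel (\<lambda>t::real. indicator {0..2 * pi} t * (C::real))"
  by (intro integrable_mult_left) (auto intro!: integrable_real_indicator)

text \<open>Orthogonality settles partial sums. Absolute convergence on the circle of radius
  \<open>r\<close> gives the constant bound \<open>B F * B G\<close>, so dominated convergence
  passes to the limit.\<close>

lemma radial_Parseval:
  fixes F G :: "complex fps"
  assumes F: "fps_conv_radius F \<ge> 1" and G: "fps_conv_radius G \<ge> 1" and r: "0 \<le> r" "r < 1"
  shows "(LINT t|lborel. indicator {0..2 * pi} t *\<^sub>R
            (eval_fps F (of_real r * cis t) * cnj (eval_fps G (of_real r * cis t))))
         = 2 * pi * (\<Sum>k. fps_nth F k * cnj (fps_nth G k) * of_real (r ^ (2 * k)))"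
    and "summable (\<lambda>k. fps_nth F k * cnj (fps_nth G k) * of_real (r ^ (2 * k)))"
proof -
  have r2: "r ^ (2 * k) = r ^ k * r ^ k" for k
    by (simp only: mult_2 power_add)
  define s where "s = (\<lambda>H N t. \<Sum>k<N. fps_nth H k * (complex_of_real r * cis t) ^ k)"
  have conv: "ereal (norm (complex_of_real r * cis t)) < fps_conv_radius H"
    if "fps_conv_radius H \<ge> 1" for H :: "complex fps" and t
  proof -
    have "ereal (norm (complex_of_real r * cis t)) < 1"
      using r by (simp add: norm_mult)
    then show ?thesis using that by (rule less_le_trans)
  qed
  have s_lim: "(\<lambda>N. s H N t) \<longlonglongrightarrow> eval_fps H (of_real r * cis t)"
    if "fps_conv_radius H \<ge> 1" for H t
    unfolding s_def eval_fps_def using conv[OF that] by (intro summable_LIMSEQ summable_fps)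
  define B where "B = (\<lambda>H. \<Sum>k. cmod (fps_nth H k * of_real r ^ k))"
  have sumB: "summable (\<lambda>k. cmod (fps_nth H k * of_real r ^ k))" if "fps_conv_radius H \<ge> 1" for H
    using norm_summable_fps[OF conv[OF that, of 0]] by simp
  have s_bound: "cmod (s H N t) \<le> B H" if "fps_conv_radius H \<ge> 1" for H N t
  proof -
    have "cmod (s H N t) \<le> (\<Sum>k<N. cmod (fps_nth H k * (complex_of_real r * cis t) ^ k))"
      unfolding s_def by (rule norm_sum)
    also have "\<dots> = (\<Sum>k<N. cmod (fps_nth H k * of_real r ^ k))"
      by (simp add: norm_mult norm_power)
    also have "\<dots> \<le> B H"
      unfolding B_def using sumB[OF that] by (rule sum_le_suminf) auto
    finally show ?thesis .
  qed
  let ?int = "\<lambda>f. LINT t|lborel. indicator {0..2 * pi} t *\<^sub>R (f t :: complex)"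
  have int_s: "?int (\<lambda>t. s F N t * cnj (s G N t))
      = (\<Sum>k<N. 2 * pi * (fps_nth F k * cnj (fps_nth G k) * of_real (r ^ (2 * k))))" for N
  proof -
    have "has_bochner_integral lborel (\<lambda>t. \<Sum>k<N. \<Sum>l<N.
        (fps_nth F k * of_real r ^ k * cnj (fps_nth G l * of_real r ^ l)) *
        (indicator {0..2 * pi} t *\<^sub>R (cis t ^ k * cnj (cis t ^ l))))
      (\<Sum>k<N. \<Sum>l<N. (fps_nth F k * of_real r ^ k * cnj (fps_nth G l * of_real r ^ l)) *
        (if k = l then 2 * pi else 0))"
      by (intro has_bochner_integral_sum has_bochner_integral_mult_right has_bochner_integral_cis_power)
    moreover have "(\<Sum>k<N. \<Sum>l<N.
        (fps_nth F k * of_real r ^ k * cnj (fps_nth G l * of_real r ^ l)) *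
        (indicator {0..2 * pi} t *\<^sub>R (cis t ^ k * cnj (cis t ^ l))))
      = indicator {0..2 * pi} t *\<^sub>R (s F N t * cnj (s G N t))" for t
      unfolding s_def cnj_sum sum_product scaleR_sum_right
      by (intro sum.cong refl) (simp add: power_mult_distrib scaleR_conv_of_real mult_ac)
    moreover have "(\<Sum>l<N. (fps_nth F k * of_real r ^ k * cnj (fps_nth G l * of_real r ^ l)) *
        complex_of_real (if k = l then 2 * pi else 0))
      = 2 * pi * (fps_nth F k * cnj (fps_nth G k) * of_real (r ^ (2 * k)))" if "k < N" for k
    proof -
      have "(\<Sum>l<N. (fps_nth F k * of_real r ^ k * cnj (fps_nth G l * of_real r ^ l)) *
          complex_of_real (if k = l then 2 * pi else 0))
        = (\<Sum>l<N. if k = l then (fps_nth F k * of_real r ^ k * cnj (fps_nth G l * of_real r ^ l)) *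
            (2 * pi) else 0)"
        by (intro sum.cong) auto
      also have "\<dots> = fps_nth F k * of_real r ^ k * cnj (fps_nth G k * of_real r ^ k) * (2 * pi)"
        using that by (simp add: sum.delta)
      also have "\<dots> = 2 * pi * (fps_nth F k * cnj (fps_nth G k) * of_real (r ^ (2 * k)))"
        unfolding r2 by (simp add: mult_ac)
      finally show ?thesis .
    qed
    ultimately show ?thesis
      by (simp add: has_bochner_integral_iff)
  qed
  have lim: "(\<lambda>N. ?int (\<lambda>t. s F N t * cnj (s G N t)))
      \<longlonglongrightarrow> ?int (\<lambda>t. eval_fps F (of_real r * cis t) * cnj (eval_fps G (of_real r * cis t)))"
  proof (rule integral_dominated_convergence)
    show "(\<lambda>t. indicator {0..2 * pi} t *\<^sub>R (s F N t * cnj (s G N t))) \<in> borel_measurable lborel" for N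
      unfolding s_def
      by (intro borel_measurable_scaleR borel_measurable_times borel_measurable_indicator)
         (auto intro!: borel_measurable_continuous_onI continuous_intros)
    then show "(\<lambda>t. indicator {0..2 * pi} t *\<^sub>R
        (eval_fps F (of_real r * cis t) * cnj (eval_fps G (of_real r * cis t)))) \<in> borel_measurable lborel"
      by (rule borel_measurable_LIMSEQ_metric) (use F G in \<open>auto intro!: tendsto_intros s_lim\<close>)
    show "AE t in lborel. (\<lambda>N. indicator {0..2 * pi} t *\<^sub>R (s F N t * cnj (s G N t)))
        \<longlonglongrightarrow> indicator {0..2 * pi} t *\<^sub>R (eval_fps F (of_real r * cis t) * cnj (eval_fps G (of_real r * cis t)))"
      by (rule AE_I2) (use F G in \<open>auto intro!: tendsto_intros s_lim\<close>)
    show "integrable lborel (\<lambda>t. indicator {0..2 * pi} t * (B F * B G))"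
      by (rule integrable_indicator_Icc_const)
    have "cmod (s F N t) * cmod (s G N t) \<le> B F * B G" for N t
      using s_bound F G order_trans[OF norm_ge_zero s_bound[OF F]] by (intro mult_mono) auto
    then show "AE t in lborel. norm (indicator {0..2 * pi} t *\<^sub>R (s F N t * cnj (s G N t)))
        \<le> indicator {0..2 * pi} t * (B F * B G)" for N
      by (intro AE_I2) (auto simp: norm_mult split: split_indicator)
  qed
  have sum: "summable (\<lambda>k. fps_nth F k * cnj (fps_nth G k) * of_real (r ^ (2 * k)))"
  proof (rule summable_comparison_test')
    show "summable (\<lambda>k. B F * cmod (fps_nth G k * of_real r ^ k))"
      using sumB[OF G] by (rule summable_mult)
    fix k
    have "cmod (fps_nth F k * of_real r ^ k) \<le> B F"
      unfolding B_def
      using sum_le_suminf[OF sumB[OF F], of "{k}"] by auto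
    then have "cmod (fps_nth F k * of_real r ^ k) * cmod (fps_nth G k * of_real r ^ k)
        \<le> B F * cmod (fps_nth G k * of_real r ^ k)"
      by (rule mult_right_mono) auto
    then show "norm (fps_nth F k * cnj (fps_nth G k) * of_real (r ^ (2 * k)))
        \<le> B F * cmod (fps_nth G k * of_real r ^ k)"
      unfolding r2 by (simp add: norm_mult norm_power mult_ac)
  qed
  then show "summable (\<lambda>k. fps_nth F k * cnj (fps_nth G k) * of_real (r ^ (2 * k)))" .
  have "(\<lambda>N. \<Sum>k<N. 2 * pi * (fps_nth F k * cnj (fps_nth G k) * of_real (r ^ (2 * k))))
      \<longlonglongrightarrow> (\<Sum>k. 2 * pi * (fps_nth F k * cnj (fps_nth G k) * of_real (r ^ (2 * k))))"
    using summable_mult[OF sum] by (rule summable_LIMSEQ)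
  then have "?int (\<lambda>t. eval_fps F (of_real r * cis t) * cnj (eval_fps G (of_real r * cis t)))
      = (\<Sum>k. 2 * pi * (fps_nth F k * cnj (fps_nth G k) * of_real (r ^ (2 * k))))"
    using LIMSEQ_unique[OF lim] by (simp only: int_s)
  also have "\<dots> = 2 * pi * (\<Sum>k. fps_nth F k * cnj (fps_nth G k) * of_real (r ^ (2 * k)))"
    using sum by (rule suminf_mult)
  finally show "?int (\<lambda>t. eval_fps F (of_real r * cis t) * cnj (eval_fps G (of_real r * cis t)))
      = 2 * pi * (\<Sum>k. fps_nth F k * cnj (fps_nth G k) * of_real (r ^ (2 * k)))" .
qed

lemma holomorphic_disc_fps:
  assumes "f holomorphic_on ball 0 1"
  shows disc_conv_radius: "fps_conv_radius (fps_expansion f 0) \<ge> 1"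
    and disc_eval_fps: "cmod z < 1 \<Longrightarrow> eval_fps (fps_expansion f 0) z = f z"
  using assms conv_radius_fps_expansion[of f 0 1] eval_fps_expansion'[of f 0 1 z]
  by (simp_all add: one_ereal_def)

text \<open>By \<open>radial_Parseval\<close> each sum is the mean of
  \<open>m z * z ^ n * cnj (m z)\<close> over a circle of radius \<open>r k\<close>. Dominated
  convergence moves to the boundary, where \<open>m\<close> is unimodular almost everywhere, and
  leaves the mean of \<open>cis t ^ n\<close>. The radii \<open>r k\<close> form a sequence in [0,
  1) tending to 1.\<close>

lemma inner_function_radial_limit:
  assumes "inner_function m"
  defines "M \<equiv> fps_expansion m 0" and "r \<equiv> (\<lambda>k::nat. 1 - 1 / real (k + 2))"
  shows "(\<lambda>k. \<Sum>j. fps_nth (M * fps_X ^ n) j * cnj (fps_nth M j) * of_real (r k ^ (2 * j)))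
           \<longlonglongrightarrow> (if n = 0 then 1 else 0)"
proof -
  have hol: "m holomorphic_on ball 0 1" and AE: "AE t in lborel. t \<in> {0..2*pi} \<longrightarrow>
        (\<exists>l. ((\<lambda>r. m (complex_of_real r * cis t)) \<longlongrightarrow> l) (at_left 1) \<and> norm l = 1)"
    using assms(1) by (simp_all add: inner_function_def Hinf_def)
  obtain B where "\<forall>z\<in>ball 0 1. cmod (m z) \<le> B"
    using assms(1) unfolding inner_function_def Hinf_def by blast
  then have B: "cmod z < 1 \<Longrightarrow> cmod (m z) \<le> B" for z
    by simp
  have r: "0 \<le> r k" "r k < 1" for k
    by (auto simp: r_def field_simps)
  have r_lim: "r \<longlonglongrightarrow> 1"
    unfolding r_def by real_asymp
  have r_left: "filterlim r (at_left 1) sequentially"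
    unfolding filterlim_at using r_lim r by (auto simp: less_imp_neq)
  have norm_rcis: "cmod (complex_of_real (r k) * cis t) < 1" for k t
    using r by (simp add: norm_mult)
  have cM: "fps_conv_radius M \<ge> 1"
    unfolding M_def using hol by (rule disc_conv_radius)
  have cMX: "fps_conv_radius (M * fps_X ^ n) \<ge> 1"
    using cM by (intro order_trans[OF _ fps_conv_radius_mult]) simp
  let ?z = "\<lambda>k t. complex_of_real (r k) * cis t"
  have eM: "eval_fps M (?z k t) = m (?z k t)" for k t
    unfolding M_def using hol norm_rcis by (rule disc_eval_fps)
  have "ereal (cmod (?z k t)) < fps_conv_radius M" for k t
    using cM norm_rcis[of k t] by (metis ereal_less(3) less_le_trans)
  then have eMX: "eval_fps (M * fps_X ^ n) (?z k t) = m (?z k t) * ?z k t ^ n" for k t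
    by (simp add: eval_fps_mult eval_fps_X_power eM)
  have m_cont: "continuous_on UNIV (\<lambda>t. m (?z k t))" for k
    by (rule continuous_on_compose2[OF holomorphic_on_imp_continuous_on[OF hol]])
       (use norm_rcis in \<open>auto intro!: continuous_intros\<close>)
  let ?f = "\<lambda>k t. indicator {0..2 * pi} t *\<^sub>R (m (?z k t) * ?z k t ^ n * cnj (m (?z k t)))"
  \<comment> \<open>The factor \<open>cnj (cis t ^ 0)\<close> equals 1 and matches the orthogonality
    relation with exponents \<open>n\<close> and 0.\<close>
  let ?g = "\<lambda>t. indicator {0..2 * pi} t *\<^sub>R (cis t ^ n * cnj (cis t ^ 0))"
  have 1: "(\<lambda>k. integral\<^sup>L lborel (?f k)) \<longlonglongrightarrow> integral\<^sup>L lborel ?g"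
  proof (rule integral_dominated_convergence)
    show "?g \<in> borel_measurable lborel"
      by (intro borel_measurable_scaleR borel_measurable_times borel_measurable_indicator)
         (auto intro!: borel_measurable_continuous_onI continuous_intros)
    show "?f k \<in> borel_measurable lborel" for k
      by (intro borel_measurable_scaleR borel_measurable_times borel_measurable_indicator)
         (auto intro!: borel_measurable_continuous_onI continuous_intros m_cont)
    show "integrable lborel (\<lambda>t. indicator {0..2 * pi} t * B\<^sup>2)"
      by (rule integrable_indicator_Icc_const)
    show "AE t in lborel. norm (?f k t) \<le> indicator {0..2 * pi} t * B\<^sup>2" for k
    proof (rule AE_I2)
      fix t
      have "cmod (?z k t) ^ n \<le> 1"
        using norm_rcis[of k t] by (intro power_le_one) auto
      then have "cmod (m (?z k t)) * cmod (?z k t) ^ n * cmod (m (?z k t)) \<le> B * 1 * B"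
        using B[OF norm_rcis] order_trans[OF norm_ge_zero B[OF norm_rcis]]
        by (intro mult_mono) auto
      then show "norm (?f k t) \<le> indicator {0..2 * pi} t * B\<^sup>2"
        by (auto simp: norm_mult norm_power power2_eq_square split: split_indicator)
    qed
    show "AE t in lborel. (\<lambda>k. ?f k t) \<longlonglongrightarrow> ?g t"
      using AE
    proof eventually_elim
      case (elim t)
      show ?case
      proof (cases "t \<in> {0..2 * pi}")
        case True
        then obtain l where l: "((\<lambda>r. m (complex_of_real r * cis t)) \<longlongrightarrow> l) (at_left 1)" "norm l = 1"
          using elim by blast
        have "(\<lambda>k. m (?z k t)) \<longlonglongrightarrow> l"
          using filterlim_compose[OF l(1) r_left] .
        then have "(\<lambda>k. m (?z k t) * ?z k t ^ n * cnj (m (?z k t))) \<longlonglongrightarrow> l * (of_real 1 * cis t) ^ n * cnj l"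
          using r_lim by (intro tendsto_intros)
        moreover have "l * (of_real 1 * cis t) ^ n * cnj l = cis t ^ n * cnj (cis t ^ 0)"
          using l(2) complex_norm_square[of l] by (simp add: mult.commute mult.left_commute)
        ultimately have "(\<lambda>k. m (?z k t) * ?z k t ^ n * cnj (m (?z k t))) \<longlonglongrightarrow> cis t ^ n * cnj (cis t ^ 0)"
          by (simp only:)
        then show ?thesis
          using True by simp
      qed simp
    qed
  qed
  have 2: "integral\<^sup>L lborel ?g = (if n = 0 then 2 * pi else 0)"
    using has_bochner_integral_cis_power[of n 0] by (rule has_bochner_integral_integral_eq)
  have 3: "integral\<^sup>L lborel (?f k)
      = 2 * pi * (\<Sum>j. fps_nth (M * fps_X ^ n) j * cnj (fps_nth M j) * of_real (r k ^ (2 * j)))" for k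
    using radial_Parseval(1)[OF cMX cM r] by (simp only: eM eMX)
  have "(\<lambda>k. integral\<^sup>L lborel (?f k) / of_real (2 * pi)) \<longlonglongrightarrow> integral\<^sup>L lborel ?g / of_real (2 * pi)"
    using 1 by (intro tendsto_divide tendsto_const) simp_all
  moreover have "integral\<^sup>L lborel (?f k) / of_real (2 * pi)
      = (\<Sum>j. fps_nth (M * fps_X ^ n) j * cnj (fps_nth M j) * of_real (r k ^ (2 * j)))" for k
    unfolding 3 by simp
  moreover have "integral\<^sup>L lborel ?g / of_real (2 * pi) = (if n = 0 then 1 else 0)"
    unfolding 2 by simp
  ultimately show ?thesis
    by (simp only:)
qed

text \<open>The radial limit for \<open>n = 0\<close> gives square summability; for general
  \<open>n\<close>, limit and sum are then interchanged.\<close>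

theorem inner_function_isometric_multiplier:
  assumes "inner_function m"
  shows "isometric_multiplier (fps_expansion m 0)"
proof -
  define M where "M = fps_expansion m 0"
  define r where "r = (\<lambda>k::nat. 1 - 1 / real (k + 2))"
  have lim: "(\<lambda>k. \<Sum>j. fps_nth (M * fps_X ^ n) j * cnj (fps_nth M j) * of_real (r k ^ (2 * j)))
      \<longlonglongrightarrow> (if n = 0 then 1 else 0)" for n
    unfolding M_def r_def by (rule inner_function_radial_limit[OF assms])
  have r: "0 \<le> r k" "r k < 1" for k
    by (auto simp: r_def field_simps)
  have r_lim: "r \<longlonglongrightarrow> 1"
    unfolding r_def by real_asymp
  have cM: "fps_conv_radius M \<ge> 1"
    unfolding M_def using assms by (intro disc_conv_radius) (auto simp: inner_function_def Hinf_def)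
  have eq: "of_real ((cmod (fps_nth M j))\<^sup>2 * r k ^ (2 * j))
      = fps_nth M j * cnj (fps_nth M j) * of_real (r k ^ (2 * j))" for j k
    unfolding of_real_mult complex_norm_square ..
  have summ: "summable (\<lambda>j. (cmod (fps_nth M j))\<^sup>2 * r k ^ (2 * j))" for k
    using radial_Parseval(2)[OF cM cM r, of k] unfolding eq[symmetric] summable_of_real_iff .
  have lim0: "(\<lambda>k. \<Sum>j. (cmod (fps_nth M j))\<^sup>2 * r k ^ (2 * j)) \<longlonglongrightarrow> 1"
  proof -
    have "(\<lambda>k. complex_of_real (\<Sum>j. (cmod (fps_nth M j))\<^sup>2 * r k ^ (2 * j))) \<longlonglongrightarrow> of_real 1"
      using lim[of 0] unfolding suminf_of_real[OF summ] eq by simp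
    then show ?thesis
      by (simp only: tendsto_of_real_iff)
  qed
  \<comment> \<open>For fixed \<open>N\<close>, the partial sum at radius \<open>r k\<close> is at
    most the full sum, which tends to 1.\<close>
  have M_l2: "M \<in> l2"
  proof (rule l2I)
    fix N
    have "(\<lambda>k. \<Sum>j<N. (cmod (fps_nth M j))\<^sup>2 * r k ^ (2 * j)) \<longlonglongrightarrow> (\<Sum>j<N. (cmod (fps_nth M j))\<^sup>2 * 1 ^ (2 * j))"
      using r_lim by (intro tendsto_intros)
    then have "(\<Sum>j<N. (cmod (fps_nth M j))\<^sup>2 * 1 ^ (2 * j)) \<le> 1"
      by (rule LIMSEQ_le[OF _ lim0])
         (use summ r in \<open>auto intro!: exI[of _ 0] sum_le_suminf mult_nonneg_nonneg\<close>)
    then show "(\<Sum>j<N. (cmod (fps_nth M j))\<^sup>2) \<le> 1"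
      by simp
  qed
  have MX: "M * fps_X ^ n \<in> l2" for n
    using l2_X_power_mult[OF M_l2] by (simp add: mult.commute)
  have "l2_inner (M * fps_X ^ n) M = (if n = 0 then 1 else 0)" for n
  proof (rule LIMSEQ_unique[OF _ lim[of n]])
    let ?a = "\<lambda>j k. fps_nth (M * fps_X ^ n) j * cnj (fps_nth M j) * of_real (r k ^ (2 * j))"
    have "(\<lambda>k. ?a j k) \<longlonglongrightarrow> fps_nth (M * fps_X ^ n) j * cnj (fps_nth M j) * of_real (1 ^ (2 * j))" for j
      using r_lim by (intro tendsto_intros)
    then have lim_a: "(\<lambda>k. ?a j k) \<longlonglongrightarrow> fps_nth (M * fps_X ^ n) j * cnj (fps_nth M j)" for j
      by simp
    \<comment> \<open>This majorant is independent of \<open>k\<close> and summable over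
      \<open>j\<close>, as Tannery's theorem requires.\<close>
    have "norm (?a j k) \<le> cmod (fps_nth (M * fps_X ^ n) j) * cmod (fps_nth M j)" for j k
    proof -
      have "r k ^ (2 * j) \<le> 1"
        using r[of k] by (intro power_le_one) auto
      then have "cmod (fps_nth (M * fps_X ^ n) j) * cmod (fps_nth M j) * r k ^ (2 * j)
          \<le> cmod (fps_nth (M * fps_X ^ n) j) * cmod (fps_nth M j) * 1"
        by (intro mult_left_mono) auto
      then show ?thesis
        using r[of k] by (simp add: norm_mult norm_power)
    qed
    then have "\<forall>\<^sub>F (j, k) in at_top \<times>\<^sub>F sequentially.
        norm (?a j k) \<le> cmod (fps_nth (M * fps_X ^ n) j) * cmod (fps_nth M j)"
      by (intro always_eventually) auto
    then show "(\<lambda>k. suminf (\<lambda>j. ?a j k)) \<longlonglongrightarrow> l2_inner (M * fps_X ^ n) M"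
      unfolding l2_inner_def
      using tannerys_theorem[OF lim_a _ summable_norm_l2_inner[OF MX M_l2]] by simp
  qed
  then show ?thesis
    using M_l2 unfolding M_def[symmetric] by unfold_locales
qed

section \<open>The Hardy space\<close>

text \<open>The value 0 outside the disc meets the normalization in \<open>H2\<close>, which makes
  \<open>of_l2\<close> and the Taylor map mutually inverse.\<close>

definition of_l2 :: "complex fps \<Rightarrow> complex \<Rightarrow> complex" where
  "of_l2 F = (\<lambda>z. if cmod z < 1 then eval_fps F z else 0)"

abbreviation taylor :: "(complex \<Rightarrow> complex) \<Rightarrow> complex fps" where
  "taylor f \<equiv> fps_expansion f 0"

lemma h2_coeff_taylor: "h2_coeff f n = fps_nth (taylor f) n"
  by (simp add: h2_coeff_def fps_expansion_def)

lemma h2_inner_taylor: "h2_inner f g = l2_inner (taylor f) (taylor g)"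
  by (simp add: h2_inner_def l2_inner_def h2_coeff_taylor)

lemma h2_norm_taylor: "h2_norm f = sqrt (l2_normsq (taylor f))"
  by (simp add: h2_norm_def l2_normsq_def h2_coeff_taylor)

lemma H2_iff: "f \<in> H2 \<longleftrightarrow> f holomorphic_on ball 0 1 \<and> (\<forall>z. cmod z \<ge> 1 \<longrightarrow> f z = 0) \<and> taylor f \<in> l2"
  by (auto simp: H2_def l2_def h2_coeff_taylor)

lemma H2_holomorphic: "f \<in> H2 \<Longrightarrow> f holomorphic_on ball 0 1"
  by (simp add: H2_iff)

lemma taylor_l2 [intro]: "f \<in> H2 \<Longrightarrow> taylor f \<in> l2"
  by (simp add: H2_iff)

lemma has_fps_expansion_taylor: "f holomorphic_on ball 0 1 \<Longrightarrow> f has_fps_expansion taylor f"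
  by (rule has_fps_expansion_fps_expansion[of "ball 0 1"]) auto

lemma taylor_add:
  "f holomorphic_on ball 0 1 \<Longrightarrow> g holomorphic_on ball 0 1 \<Longrightarrow> taylor (\<lambda>z. f z + g z) = taylor f + taylor g"
  by (intro fps_expansion_eqI has_fps_expansion_add has_fps_expansion_taylor)

lemma taylor_diff:
  "f holomorphic_on ball 0 1 \<Longrightarrow> g holomorphic_on ball 0 1 \<Longrightarrow> taylor (\<lambda>z. f z - g z) = taylor f - taylor g"
  by (intro fps_expansion_eqI has_fps_expansion_diff has_fps_expansion_taylor)

lemma taylor_mult:
  "f holomorphic_on ball 0 1 \<Longrightarrow> g holomorphic_on ball 0 1 \<Longrightarrow> taylor (\<lambda>z. f z * g z) = taylor f * taylor g"
  by (intro fps_expansion_eqI has_fps_expansion_mult has_fps_expansion_taylor)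

lemma taylor_cmult: "f holomorphic_on ball 0 1 \<Longrightarrow> taylor (\<lambda>z. c * f z) = fps_const c * taylor f"
  by (intro fps_expansion_eqI has_fps_expansion_mult has_fps_expansion_const has_fps_expansion_taylor)

lemma taylor_shift: "f holomorphic_on ball 0 1 \<Longrightarrow> taylor (shift f) = fps_X * taylor f"
  unfolding shift_def
  by (intro fps_expansion_eqI has_fps_expansion_mult has_fps_expansion_fps_X has_fps_expansion_taylor)

lemma taylor_zero [simp]: "taylor (\<lambda>z. 0) = 0"
  by (intro fps_expansion_eqI has_fps_expansion_0)

lemma taylor_of_l2 [simp]:
  assumes "F \<in> l2"
  shows "taylor (of_l2 F) = F"
proof (rule fps_expansion_eqI)
  have "\<forall>\<^sub>F z in nhds 0. eval_fps F z = of_l2 F z"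
    by (rule eventually_nhds_in_open[of "ball 0 1", THEN eventually_mono]) (auto simp: of_l2_def)
  then show "of_l2 F has_fps_expansion F"
    using l2_conv_radius[OF assms] by (auto simp: has_fps_expansion_def intro: less_le_trans[of 0 1])
qed

lemma less_conv_radius: "cmod z < 1 \<Longrightarrow> fps_conv_radius F \<ge> 1 \<Longrightarrow> ereal (cmod z) < fps_conv_radius F"
  by (metis ereal_less(3) less_le_trans)

lemma of_l2_H2 [intro]:
  assumes "F \<in> l2"
  shows "of_l2 F \<in> H2"
proof -
  have "eval_fps F holomorphic_on ball 0 1"
    using l2_conv_radius[OF assms]
    by (intro holomorphic_on_eval_fps) (auto intro: less_conv_radius)
  then have "of_l2 F holomorphic_on ball 0 1"
    by (rule holomorphic_transform) (auto simp: of_l2_def)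
  then show ?thesis
    using assms by (auto simp: H2_iff) (auto simp: of_l2_def)
qed

lemma of_l2_taylor [simp]:
  assumes "f \<in> H2"
  shows "of_l2 (taylor f) = f"
  using assms disc_eval_fps[OF H2_holomorphic[OF assms]] by (auto simp: of_l2_def H2_iff)

lemma taylor_inject: "f \<in> H2 \<Longrightarrow> g \<in> H2 \<Longrightarrow> taylor f = taylor g \<Longrightarrow> f = g"
  by (metis of_l2_taylor)

lemma H2_add [intro]: "f \<in> H2 \<Longrightarrow> g \<in> H2 \<Longrightarrow> (\<lambda>z. f z + g z) \<in> H2"
  by (auto simp: H2_iff taylor_add intro!: holomorphic_intros)

lemma H2_cmult [intro]: "f \<in> H2 \<Longrightarrow> (\<lambda>z. c * f z) \<in> H2"
  by (auto simp: H2_iff taylor_cmult intro!: holomorphic_intros)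

lemma H2_zero [simp]: "(\<lambda>z. 0) \<in> H2"
  by (auto simp: H2_iff)

lemma H2_shift [intro]: "f \<in> H2 \<Longrightarrow> shift f \<in> H2"
  by (auto simp: H2_iff taylor_shift) (auto simp: shift_def intro!: holomorphic_intros)

lemma of_l2_zero [simp]: "of_l2 0 = (\<lambda>z. 0)"
  by (auto simp: of_l2_def)

section \<open>Evaluation on the disc: evenness and Blaschke quotients\<close>

lemma eval_lin [simp]: "eval_fps (lin a b) z = a + b * z"
proof -
  have "eval_fps (lin a b) z = (\<Sum>n<2. fps_nth (lin a b) n * z ^ n)"
    unfolding eval_fps_def by (rule suminf_finite) (auto simp: lin_nth)
  then show ?thesis
    by (simp add: lin_nth numeral_2_eq_2)
qed

lemma eval_flip: "eval_fps (flip F) z = eval_fps F (- z)"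
  unfolding eval_fps_def by (rule arg_cong[where f = suminf]) (auto simp: power_minus[of z])

lemma conv_radius_flip [simp]: "fps_conv_radius (flip F) = fps_conv_radius F"
  by (simp add: fps_conv_radius_def conv_radius_def norm_mult norm_power)

lemma conv_radius_lin [simp]: "fps_conv_radius (lin a b) = \<infinity>"
proof -
  have "conv_radius (fps_nth (lin a b)) = \<infinity>"
    by (rule conv_radius_cong'[THEN trans, of _ "\<lambda>_. 0 :: complex"])
       (auto intro!: eventually_mono[OF eventually_gt_at_top[of 1]] simp: lin_nth)
  then show ?thesis
    by (simp add: fps_conv_radius_def)
qed

lemma fps_disc_eqI:
  fixes F G :: "complex fps"
  assumes "fps_conv_radius F \<ge> 1" "fps_conv_radius G \<ge> 1" "\<And>z. cmod z < 1 \<Longrightarrow> eval_fps F z = eval_fps G z"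
  shows "F = G"
proof (rule eval_fps_eqD)
  show "fps_conv_radius F > 0" "fps_conv_radius G > 0"
    using assms(1,2) by (auto intro: less_le_trans[of 0 1])
  show "\<forall>\<^sub>F z in nhds 0. eval_fps F z = eval_fps G z"
    by (rule eventually_nhds_in_open[of "ball 0 1", THEN eventually_mono]) (auto simp: assms(3))
qed

lemma even_fps_iff_eval:
  assumes "fps_conv_radius F \<ge> 1"
  shows "even_fps F \<longleftrightarrow> (\<forall>z\<in>ball 0 1. eval_fps F z = eval_fps F (- z))"
proof
  assume "even_fps F"
  then show "\<forall>z\<in>ball 0 1. eval_fps F z = eval_fps F (- z)"
    using eval_flip[of F] by (simp add: even_fps_iff_flip)
next
  assume ev: "\<forall>z\<in>ball 0 1. eval_fps F z = eval_fps F (- z)"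
  have "flip F = F"
  proof (rule fps_disc_eqI)
    show "eval_fps (flip F) z = eval_fps F z" if "cmod z < 1" for z
      using bspec[OF ev, of z] that by (simp add: eval_flip)
  qed (use assms in auto)
  then show "even_fps F"
    by (simp add: even_fps_iff_flip)
qed

lemma one_plus_cnj_mult_nonzero:
  assumes "cmod \<mu> < 1" "cmod z < 1"
  shows "1 + cnj \<mu> * z \<noteq> 0"
proof
  assume "1 + cnj \<mu> * z = 0"
  then have "cnj \<mu> * z = - 1"
    by (simp add: eq_neg_iff_add_eq_0 add.commute)
  then have "cmod \<mu> * cmod z = 1"
    by (metis complex_mod_cnj norm_minus_cancel norm_mult norm_one)
  moreover have "cmod \<mu> * cmod z < 1 * 1"
    using assms by (intro mult_strict_mono') auto
  ultimately show False by simp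
qed

text \<open>Away from \<open>- \<mu>\<close> the factor \<open>z + \<mu>\<close> is bounded below,
  so the bound on \<open>m\<close> carries over to \<open>p\<close>; on a smaller closed disc
  containing \<open>- \<mu>\<close>, compactness bounds \<open>p\<close>.\<close>

lemma Hinf_quotient_Blaschke:
  assumes m: "m \<in> Hinf" and p: "p holomorphic_on ball 0 1" and \<mu>: "cmod \<mu> < 1"
    and eq: "\<And>z. cmod z < 1 \<Longrightarrow> m z * (1 + cnj \<mu> * z) = (z + \<mu>) * p z"
  shows "p \<in> Hinf"
proof -
  obtain B where "\<forall>z\<in>ball 0 1. cmod (m z) \<le> B"
    using m unfolding Hinf_def by blast
  then have B: "cmod z < 1 \<Longrightarrow> cmod (m z) \<le> B" for z
    by simp
  \<comment> \<open>The midpoint of \<open>cmod \<mu>\<close> and 1; outside radius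
    \<open>\<rho>\<close> the modulus of \<open>z + \<mu>\<close> is at least
    \<open>\<rho> - cmod \<mu>\<close>.\<close>
  define \<rho> where "\<rho> = (1 + cmod \<mu>) / 2"
  have \<rho>: "\<rho> < 1" "cmod \<mu> < \<rho>"
    using \<mu> by (auto simp: \<rho>_def)
  have "compact (p ` cball 0 \<rho>)"
    using \<rho> by (intro compact_continuous_image continuous_on_subset[OF holomorphic_on_imp_continuous_on[OF p]]) auto
  then obtain C where C: "\<And>z. cmod z \<le> \<rho> \<Longrightarrow> cmod (p z) \<le> C"
    using compact_imp_bounded bounded_iff by (metis (no_types, lifting) image_eqI mem_cball_0)
  have "cmod (p z) \<le> max C (B * 2 / (\<rho> - cmod \<mu>))" if z: "cmod z < 1" for z
  proof (cases "cmod z \<le> \<rho>")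
    case False
    have "\<rho> - cmod \<mu> \<le> cmod (z + \<mu>)"
      using False norm_diff_ineq[of z \<mu>] by simp
    then have "(\<rho> - cmod \<mu>) * cmod (p z) \<le> cmod (z + \<mu>) * cmod (p z)"
      by (rule mult_right_mono) auto
    also have "\<dots> = cmod (m z) * cmod (1 + cnj \<mu> * z)"
      using eq[OF z] by (metis norm_mult)
    also have "\<dots> \<le> B * 2"
    proof (rule mult_mono)
      have "cmod (1 + cnj \<mu> * z) \<le> 1 + cmod \<mu> * cmod z"
        using norm_triangle_ineq[of 1 "cnj \<mu> * z"] by (simp add: norm_mult)
      moreover have "cmod \<mu> * cmod z \<le> 1 * 1"
        using \<mu> z by (intro mult_mono) auto
      ultimately show "cmod (1 + cnj \<mu> * z) \<le> 2" by simp
    qed (use B[OF z] order_trans[OF norm_ge_zero B[OF z]] in auto)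
    finally have "cmod (p z) \<le> B * 2 / (\<rho> - cmod \<mu>)"
      using \<rho> by (simp add: pos_le_divide_eq mult.commute)
    then show ?thesis by simp
  qed (simp add: C le_max_iff_disj)
  then show ?thesis
    unfolding Hinf_def using p by (intro CollectI conjI exI ballI) auto
qed

section \<open>Transfer of projection, operator, adjoint and subspaces to power series\<close>

locale inner_model =
  fixes m :: "complex \<Rightarrow> complex"
  assumes inner: "inner_function m"
begin

sublocale isometric_multiplier "taylor m"
  using inner by (rule inner_function_isometric_multiplier)

abbreviation T2 :: "(complex \<Rightarrow> complex) \<Rightarrow> complex \<Rightarrow> complex" where
  "T2 h \<equiv> compressed_shift m (compressed_shift m h)"

lemma m_holomorphic: "m holomorphic_on ball 0 1" and m_Hinf: "m \<in> Hinf"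
  using inner by (auto simp: inner_function_def Hinf_def)

lemma model_space_iff: "f \<in> model_space m \<longleftrightarrow> f \<in> H2 \<and> taylor f \<in> model"
proof -
  have "(\<forall>g\<in>H2. h2_inner f (\<lambda>z. m z * g z) = 0) \<longleftrightarrow> (\<forall>G\<in>l2. l2_inner (taylor f) (taylor m * G) = 0)"
    (is "?L \<longleftrightarrow> ?R")
  proof
    assume L: ?L
    show ?R
    proof
      fix G assume "G \<in> l2"
      then show "l2_inner (taylor f) (taylor m * G) = 0"
        using bspec[OF L of_l2_H2[of G]] m_holomorphic H2_holomorphic[OF of_l2_H2[of G]]
        by (simp add: h2_inner_taylor taylor_mult)
    qed
  next
    assume ?R
    then show ?L
      using m_holomorphic by (auto simp: h2_inner_taylor taylor_mult H2_holomorphic)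
  qed
  then show ?thesis
    by (auto simp: model_space_def model_def)
qed

lemma of_l2_model: "F \<in> model \<Longrightarrow> of_l2 F \<in> model_space m"
  by (auto simp: model_space_iff model_l2)

text \<open>The \<open>THE\<close> in \<open>proj\<close> calls for uniqueness: the difference
  \<open>D\<close> of two candidates lies in \<open>model\<close> and is orthogonal to
  itself.\<close>

lemma proj_model_space:
  assumes f: "f \<in> H2"
  shows "proj (model_space m) f = of_l2 (model_proj (taylor f))"
  unfolding proj_def
proof (rule the_equality)
  let ?g = "of_l2 (model_proj (taylor f))"
  have F: "taylor f \<in> l2" using f by auto
  have g: "?g \<in> model_space m"
    using F by (intro of_l2_model) auto
  have Tg: "taylor ?g = model_proj (taylor f)"
    using F by (intro taylor_of_l2) auto
  show "?g \<in> model_space m \<and> (\<forall>k\<in>model_space m. h2_inner (\<lambda>z. f z - ?g z) k = 0)"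
  proof (intro conjI ballI g)
    fix k assume "k \<in> model_space m"
    then have k: "taylor k \<in> model"
      by (simp add: model_space_iff)
    have "taylor (\<lambda>z. f z - ?g z) = taylor m * m_adj (taylor f)"
      using f g by (simp add: taylor_diff H2_holomorphic model_space_iff Tg) (simp add: model_proj_def)
    then show "h2_inner (\<lambda>z. f z - ?g z) k = 0"
      using k F by (simp add: h2_inner_taylor inner_m_mult_model m_adj_l2)
  qed
  fix h assume h: "h \<in> model_space m \<and> (\<forall>k\<in>model_space m. h2_inner (\<lambda>z. f z - h z) k = 0)"
  then have hH: "h \<in> H2" "taylor h \<in> model"
    by (auto simp: model_space_iff)
  define D where "D = model_proj (taylor f) - taylor h"
  have D: "D \<in> model" "D \<in> l2"
    using F hH model_l2 by (auto simp: D_def)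
  have "l2_inner (taylor f - taylor h) D = 0"
    using h of_l2_model[OF D(1)] f hH D(2) by (auto simp: h2_inner_taylor taylor_diff H2_holomorphic)
  then have "l2_inner (model_proj (taylor f)) D = l2_inner (taylor h) D"
    using F hH D by (simp add: l2_inner_diff_left inner_model_proj_left model_l2)
  moreover have "l2_inner D D = l2_inner (model_proj (taylor f)) D - l2_inner (taylor h) D"
    using l2_inner_diff_left[of "model_proj (taylor f)" "taylor h" D] F hH D
    by (simp add: model_proj_l2 model_l2 flip: D_def)
  ultimately have "l2_inner D D = 0"
    by simp
  then have "model_proj (taylor f) = taylor h"
    using D l2_inner_self_eq_0_iff by (auto simp: D_def)
  then show "h = ?g"
    using hH by simp
qed

lemma compressed_shift_eq:
  assumes "h \<in> H2"
  shows "compressed_shift m h = of_l2 (model_proj (fps_X * taylor h))"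
  using assms by (simp add: compressed_shift_def proj_model_space H2_shift taylor_shift H2_holomorphic)

lemma T2_eq:
  assumes h: "h \<in> H2"
  shows "T2 h = of_l2 (model_proj (fps_X\<^sup>2 * taylor h))"
proof -
  have l2: "fps_X * taylor h \<in> l2"
    using h by auto
  then have "compressed_shift m h \<in> H2" "taylor (compressed_shift m h) = model_proj (fps_X * taylor h)"
    using h by (auto simp: compressed_shift_eq model_proj_l2)
  then have "T2 h = of_l2 (model_proj (fps_X * model_proj (fps_X * taylor h)))"
    by (simp add: compressed_shift_eq)
  also have "model_proj (fps_X * model_proj (fps_X * taylor h)) = model_proj (fps_X\<^sup>2 * taylor h)"
    using model_proj_X_power_mult[OF l2, of 1] by (simp add: power2_eq_square mult.assoc)
  finally show ?thesis .
qed

lemma taylor_T2: "h \<in> H2 \<Longrightarrow> taylor (T2 h) = model_proj (fps_X\<^sup>2 * taylor h)"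
  by (subst T2_eq) (auto intro!: taylor_of_l2)

text \<open>The adjoint of multiplication by \<open>fps_X\<^sup>2\<close> is the backward shift by
  two, which already preserves \<open>model\<close>, so no projection appears. Uniqueness is as for
  \<open>proj\<close>.\<close>

lemma T2_adjoint_eq:
  assumes y: "y \<in> model_space m"
  shows "op_adjoint (model_space m) T2 y = of_l2 (fps_shift 2 (taylor y))"
  unfolding op_adjoint_def
proof (rule the_equality)
  have Y: "y \<in> H2" "taylor y \<in> model" "taylor y \<in> l2"
    using y by (auto simp: model_space_iff)
  have adj: "h2_inner (T2 x) y = l2_inner (taylor x) (fps_shift 2 (taylor y))" if "x \<in> model_space m" for x
  proof -
    have x: "x \<in> H2" "taylor x \<in> l2"
      using that by (auto simp: model_space_iff)
    have "h2_inner (T2 x) y = l2_inner (fps_X\<^sup>2 * taylor x) (taylor y)"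
      using x Y by (simp add: h2_inner_taylor taylor_T2 inner_model_proj_left l2_X_power_mult)
    then show ?thesis
      using x Y by (simp add: l2_inner_X_power_mult_left)
  qed
  have S: "fps_shift 2 (taylor y) \<in> model" "fps_shift 2 (taylor y) \<in> l2"
    using Y by auto
  then show "of_l2 (fps_shift 2 (taylor y)) \<in> model_space m \<and>
      (\<forall>x\<in>model_space m. h2_inner (T2 x) y = h2_inner x (of_l2 (fps_shift 2 (taylor y))))"
    using adj by (auto simp: of_l2_model h2_inner_taylor)
  fix z assume z: "z \<in> model_space m \<and> (\<forall>x\<in>model_space m. h2_inner (T2 x) y = h2_inner x z)"
  then have Z: "z \<in> H2" "taylor z \<in> model" "taylor z \<in> l2"
    by (auto simp: model_space_iff)
  define D where "D = fps_shift 2 (taylor y) - taylor z"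
  have D: "D \<in> model" "D \<in> l2"
    using S Z by (auto simp: D_def)
  have "l2_inner D (fps_shift 2 (taylor y)) = l2_inner D (taylor z)"
    using z adj[OF of_l2_model[OF D(1)]] of_l2_model[OF D(1)] D(2) by (auto simp: h2_inner_taylor)
  then have "l2_inner D D = 0"
    using l2_inner_diff_right[OF S(2) Z(3) D(2)] by (simp flip: D_def)
  then have "fps_shift 2 (taylor y) = taylor z"
    using D l2_inner_self_eq_0_iff by (auto simp: D_def)
  then show "z = of_l2 (fps_shift 2 (taylor y))"
    using Z by simp
qed

lemma tendsto_h2_norm_iff:
  assumes "\<And>n. s n \<in> H2" "f \<in> H2"
  shows "(\<lambda>n. h2_norm (\<lambda>z. s n z - f z)) \<longlonglongrightarrow> 0 \<longleftrightarrow> (\<lambda>n. l2_normsq (taylor (s n) - taylor f)) \<longlonglongrightarrow> 0"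
proof -
  have *: "l2_normsq (taylor (s n) - taylor f) \<ge> 0" for n
    using assms by (intro l2_normsq_nonneg) auto
  have eq: "h2_norm (\<lambda>z. s n z - f z) = sqrt (l2_normsq (taylor (s n) - taylor f))" for n
    using assms by (simp add: h2_norm_taylor taylor_diff H2_holomorphic)
  show ?thesis
  proof
    assume "(\<lambda>n. h2_norm (\<lambda>z. s n z - f z)) \<longlonglongrightarrow> 0"
    then have "(\<lambda>n. (h2_norm (\<lambda>z. s n z - f z))\<^sup>2) \<longlonglongrightarrow> 0\<^sup>2"
      by (intro tendsto_intros)
    then show "(\<lambda>n. l2_normsq (taylor (s n) - taylor f)) \<longlonglongrightarrow> 0"
      using * by (simp add: eq)
  next
    assume "(\<lambda>n. l2_normsq (taylor (s n) - taylor f)) \<longlonglongrightarrow> 0"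
    then show "(\<lambda>n. h2_norm (\<lambda>z. s n z - f z)) \<longlonglongrightarrow> 0"
      unfolding eq using tendsto_real_sqrt by fastforce
  qed
qed

text \<open>The Taylor map and \<open>of_l2\<close> carry subspaces back and forth, preserving
  linear structure, closedness and both operators.\<close>

lemma reducible_on_iff:
  "reducible_on (model_space m) T2 \<longleftrightarrow> (\<exists>N. reducing N \<and> N \<noteq> {0} \<and> N \<noteq> model)"
proof
  assume "reducible_on (model_space m) T2"
  then obtain M where sub: "M \<subseteq> model_space m" and lin: "lin_subspace M" and cl: "h2_closed M"
    and ne: "M \<noteq> {\<lambda>z. 0}" "M \<noteq> model_space m"
    and inv: "\<And>x. x \<in> M \<Longrightarrow> T2 x \<in> M" "\<And>x. x \<in> M \<Longrightarrow> op_adjoint (model_space m) T2 x \<in> M"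
    unfolding reducible_on_def by blast
  have M_closed: "f \<in> M" if "\<And>n. s n \<in> M" "f \<in> H2" "(\<lambda>n. h2_norm (\<lambda>z. s n z - f z)) \<longlonglongrightarrow> 0" for s f
    using cl that unfolding h2_closed_def by blast
  have M: "f \<in> H2" "taylor f \<in> model" "f holomorphic_on ball 0 1" if "f \<in> M" for f
    using sub that by (auto simp: model_space_iff H2_holomorphic)
  define N where "N = {F \<in> l2. of_l2 F \<in> M}"
  have taylor_N: "taylor f \<in> N" if "f \<in> M" for f
    using M[OF that] that by (auto simp: N_def)
  have N: "F \<in> l2" "of_l2 F \<in> M" "F \<in> model" if "F \<in> N" for F
    using that M(2)[of "of_l2 F"] by (auto simp: N_def)
  have "reducing N"
    unfolding reducing_def
  proof (intro conjI allI ballI impI; (elim conjE)?)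
    show "N \<subseteq> model" using N by blast
    show "0 \<in> N"
      using lin by (simp add: N_def lin_subspace_def)
    show "F + G \<in> N" if "F \<in> N" "G \<in> N" for F G
    proof -
      have "(\<lambda>z. of_l2 F z + of_l2 G z) \<in> M"
        using lin N[OF that(1)] N[OF that(2)] by (simp add: lin_subspace_def)
      then show ?thesis
        using taylor_N N[OF that(1)] N[OF that(2)] by (fastforce simp: taylor_add M)
    qed
    show "fps_const c * F \<in> N" if "F \<in> N" for c F
    proof -
      have "(\<lambda>z. c * of_l2 F z) \<in> M"
        using lin N[OF that] by (simp add: lin_subspace_def)
      then show ?thesis
        using taylor_N N[OF that] by (fastforce simp: taylor_cmult M)
    qed
    show "F \<in> N" if s: "\<forall>n. s n \<in> N" and F: "F \<in> l2"
      and lim: "(\<lambda>n. l2_normsq (s n - F)) \<longlonglongrightarrow> 0" for s F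
    proof -
      have "(\<lambda>n. h2_norm (\<lambda>z. of_l2 (s n) z - of_l2 F z)) \<longlonglongrightarrow> 0"
        using s F lim N by (subst tendsto_h2_norm_iff) auto
      then have "of_l2 F \<in> M"
        using s F N(2) by (rule_tac M_closed[of "\<lambda>n. of_l2 (s n)"]) auto
      then show ?thesis using F by (simp add: N_def)
    qed
    show "model_proj (fps_X\<^sup>2 * F) \<in> N" if "F \<in> N" for F
      using taylor_N[OF inv(1)[OF N(2)[OF that]]] N[OF that] by (simp add: taylor_T2 of_l2_H2)
    show "fps_shift 2 F \<in> N" if "F \<in> N" for F
      using taylor_N[OF inv(2)[OF N(2)[OF that]]] N[OF that]
      by (simp add: T2_adjoint_eq of_l2_model l2_shift)
  qed
  moreover have M_eq: "M = of_l2 ` N"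
  proof (intro equalityI subsetI)
    fix f assume f: "f \<in> M"
    then have "f = of_l2 (taylor f)"
      using M by simp
    then show "f \<in> of_l2 ` N"
      using taylor_N[OF f] by (rule image_eqI)
  qed (use N in auto)
  moreover have "N \<noteq> {0}"
    using ne(1) M_eq by auto
  moreover have "N \<noteq> model"
  proof
    assume "N = model"
    then have "f \<in> M" if "f \<in> model_space m" for f
      using that of_l2_taylor[of f] N(2)[of "taylor f"] by (auto simp: model_space_iff)
    then show False
      using ne(2) sub by blast
  qed
  ultimately show "\<exists>N. reducing N \<and> N \<noteq> {0} \<and> N \<noteq> model"
    by blast
next
  assume "\<exists>N. reducing N \<and> N \<noteq> {0} \<and> N \<noteq> model"
  then obtain N where N: "reducing N" "N \<noteq> {0}" "N \<noteq> model"
    by blast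
  define M where "M = {f \<in> H2. taylor f \<in> N}"
  have Nl2: "F \<in> model" "F \<in> l2" if "F \<in> N" for F
    using reducing_subset[OF N(1) that] model_l2 by auto
  have of_l2_M: "of_l2 F \<in> M" if "F \<in> N" for F
    using Nl2[OF that] that by (auto simp: M_def)
  have M_model: "f \<in> model_space m" if "f \<in> M" for f
    using that Nl2 by (simp add: M_def model_space_iff)
  show "reducible_on (model_space m) T2"
    unfolding reducible_on_def
  proof (intro exI[of _ M] conjI ballI)
    show "M \<subseteq> model_space m"
      using M_model by blast
    show "lin_subspace M"
      unfolding lin_subspace_def M_def
      by (auto simp: taylor_add taylor_cmult H2_holomorphic
               intro: reducing_zero[OF N(1)] reducing_add[OF N(1)] reducing_cmult[OF N(1)])
    show "h2_closed M"
      unfolding h2_closed_def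
    proof (intro conjI allI impI; (elim conjE)?)
      show "M \<subseteq> H2" by (auto simp: M_def)
      fix s f assume s: "\<forall>n. s n \<in> M" and f: "f \<in> H2" and lim: "(\<lambda>n. h2_norm (\<lambda>z. s n z - f z)) \<longlonglongrightarrow> 0"
      have "(\<lambda>n. l2_normsq (taylor (s n) - taylor f)) \<longlonglongrightarrow> 0"
        using s f lim by (subst (asm) tendsto_h2_norm_iff) (auto simp: M_def)
      then have "taylor f \<in> N"
        using s f by (rule_tac reducing_closed[OF N(1), of "\<lambda>n. taylor (s n)"]) (auto simp: M_def)
      then show "f \<in> M"
        using f by (simp add: M_def)
    qed
    show "M \<noteq> {\<lambda>z. 0}"
    proof
      assume M0: "M = {\<lambda>z. 0}"
      have "F = 0" if "F \<in> N" for F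
        using of_l2_M[OF that] M0 taylor_of_l2[OF Nl2(2)[OF that]] by simp
      then show False
        using N(2) reducing_zero[OF N(1)] by blast
    qed
    show "M \<noteq> model_space m"
    proof
      assume eq: "M = model_space m"
      have "F \<in> N" if "F \<in> model" for F
      proof -
        have "of_l2 F \<in> M"
          using of_l2_model[OF that] eq by simp
        then show ?thesis
          using model_l2[OF that] by (simp add: M_def)
      qed
      then show False
        using N(3) Nl2 by blast
    qed
    show "T2 f \<in> M" if "f \<in> M" for f
    proof -
      have f: "f \<in> H2" "taylor f \<in> N"
        using that by (auto simp: M_def)
      show ?thesis
        unfolding T2_eq[OF f(1)] by (intro of_l2_M reducing_X2[OF N(1)] f)
    qed
    show "op_adjoint (model_space m) T2 f \<in> M" if "f \<in> M" for f
    proof -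
      have "taylor f \<in> N"
        using that by (auto simp: M_def)
      then show ?thesis
        unfolding T2_adjoint_eq[OF M_model[OF that]] by (intro of_l2_M reducing_shift2[OF N(1)])
    qed
  qed
qed

lemma dim_ge2_imp_vanishing:
  assumes "dim_ge2 (model_space m)"
  obtains x where "x \<in> model" "x \<noteq> 0" "fps_nth x 0 = 0"
proof -
  obtain f g where fg: "f \<in> model_space m" "g \<in> model_space m"
    and indep: "\<And>a b. (\<lambda>z. a * f z + b * g z) = (\<lambda>z. 0) \<Longrightarrow> a = 0 \<and> b = 0"
    using assms unfolding dim_ge2_def by blast
  have f: "f \<in> H2" "taylor f \<in> model" and g: "g \<in> H2" "taylor g \<in> model"
    using fg by (auto simp: model_space_iff)
  have comb: "a = 0 \<and> b = 0" if "fps_const a * taylor f + fps_const b * taylor g = 0" for a b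
  proof (rule indep, rule taylor_inject)
    show "taylor (\<lambda>z. a * f z + b * g z) = taylor (\<lambda>z. 0)"
      using that f g by (simp add: taylor_add taylor_cmult H2_holomorphic H2_cmult)
  qed (use f g in auto)
  show thesis
  proof (cases "fps_nth (taylor f) 0 = 0")
    case True
    have "taylor f \<noteq> 0"
      using comb[of 1 0] by auto
    then show thesis
      using that True f by blast
  next
    case False
    \<comment> \<open>The combination of the two independent elements in which the constant terms
      cancel.\<close>
    let ?x = "fps_const (- fps_nth (taylor g) 0) * taylor f + fps_const (fps_nth (taylor f) 0) * taylor g"
    have "?x \<noteq> 0"
      using comb False by blast
    moreover have "?x \<in> model"
      using f g by blast
    ultimately show thesis
      using that[of ?x] by simp
  qed
qed

lemma even_taylor_iff: "even_fps (taylor m) \<longleftrightarrow> (\<forall>z\<in>ball 0 1. m z = m (- z))"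
  using m_holomorphic by (subst even_fps_iff_eval) (auto simp: disc_conv_radius disc_eval_fps)

text \<open>The denominator has no zero in the disc, so the quotient formula can be cleared and
  compared as power series. Boundedness of \<open>p\<close> comes from
  \<open>Hinf_quotient_Blaschke\<close>.\<close>

lemma Blaschke_taylor_iff:
  "(\<exists>\<mu> p. cmod \<mu> < 1 \<and> even_fps p \<and> fps_conv_radius p \<ge> 1 \<and> taylor m * lin 1 (cnj \<mu>) = lin \<mu> 1 * p)
   \<longleftrightarrow> (\<exists>\<mu>\<in>ball 0 1. \<exists>p\<in>Hinf. (\<forall>z\<in>ball 0 1. p z = p (- z)) \<and>
        (\<forall>z\<in>ball 0 1. m z = p z * ((z + \<mu>) / (1 + cnj \<mu> * z))))" (is "?L \<longleftrightarrow> ?R")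
proof
  have cm: "fps_conv_radius (taylor m) \<ge> 1"
    using m_holomorphic by (rule disc_conv_radius)
  {
    assume ?L
    then obtain \<mu> p where \<mu>: "cmod \<mu> < 1" and p: "even_fps p" "fps_conv_radius p \<ge> 1"
      and eq: "taylor m * lin 1 (cnj \<mu>) = lin \<mu> 1 * p"
      by blast
    have hol: "eval_fps p holomorphic_on ball 0 1"
      using p(2) by (intro holomorphic_on_eval_fps) (auto intro: less_conv_radius)
    have ev: "m z * (1 + cnj \<mu> * z) = (z + \<mu>) * eval_fps p z" if "cmod z < 1" for z
      using arg_cong[OF eq, of "\<lambda>F. eval_fps F z"] less_conv_radius[OF that cm] less_conv_radius[OF that p(2)]
        disc_eval_fps[OF m_holomorphic that]
      by (simp add: eval_fps_mult add.commute)
    show ?R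
    proof (intro bexI conjI ballI)
      show "m z = eval_fps p z * ((z + \<mu>) / (1 + cnj \<mu> * z))" if "z \<in> ball 0 1" for z
        using ev[of z] one_plus_cnj_mult_nonzero[OF \<mu>, of z] that by (simp add: field_simps)
      show "eval_fps p z = eval_fps p (- z)" if "z \<in> ball 0 1" for z
        using p even_fps_iff_eval that by blast
      show "eval_fps p \<in> Hinf"
        using m_Hinf hol \<mu> ev by (rule Hinf_quotient_Blaschke)
      show "\<mu> \<in> ball 0 1"
        using \<mu> by simp
    qed
  }
  {
    assume ?R
    then obtain \<mu> p where \<mu>': "\<mu> \<in> ball 0 1" and p: "p \<in> Hinf" "\<forall>z\<in>ball 0 1. p z = p (- z)"
      and eq: "\<forall>z\<in>ball 0 1. m z = p z * ((z + \<mu>) / (1 + cnj \<mu> * z))"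
      by blast
    have \<mu>: "cmod \<mu> < 1"
      using \<mu>' by simp
    have hol: "p holomorphic_on ball 0 1"
      using p(1) by (simp add: Hinf_def)
    have cp: "fps_conv_radius (taylor p) \<ge> 1"
      using hol by (rule disc_conv_radius)
    have "taylor m * lin 1 (cnj \<mu>) = lin \<mu> 1 * taylor p"
    proof (rule fps_disc_eqI)
      show "fps_conv_radius (taylor m * lin 1 (cnj \<mu>)) \<ge> 1" "fps_conv_radius (lin \<mu> 1 * taylor p) \<ge> 1"
        using cm cp by (auto intro!: order_trans[OF _ fps_conv_radius_mult])
      fix z :: complex assume z: "cmod z < 1"
      have "eval_fps (taylor m * lin 1 (cnj \<mu>)) z = m z * (1 + cnj \<mu> * z)"
        using less_conv_radius[OF z cm] disc_eval_fps[OF m_holomorphic z] by (simp add: eval_fps_mult)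
      also have "\<dots> = (\<mu> + z) * p z"
        using bspec[OF eq, of z] z one_plus_cnj_mult_nonzero[OF \<mu> z] by (simp add: field_simps)
      also have "\<dots> = eval_fps (lin \<mu> 1 * taylor p) z"
        using less_conv_radius[OF z cp] disc_eval_fps[OF hol z] by (simp add: eval_fps_mult)
      finally show "eval_fps (taylor m * lin 1 (cnj \<mu>)) z = eval_fps (lin \<mu> 1 * taylor p) z" .
    qed
    moreover have "even_fps (taylor p)"
      unfolding even_fps_iff_eval[OF cp]
    proof
      fix z :: complex assume "z \<in> ball 0 1"
      then show "eval_fps (taylor p) z = eval_fps (taylor p) (- z)"
        using bspec[OF p(2), of z] by (simp add: disc_eval_fps[OF hol])
    qed
    ultimately show ?L
      using \<mu> cp by blast
  }
qed

end

theorem theorem1: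
  fixes m :: "complex \<Rightarrow> complex"
  assumes "inner_function m"
    and "dim_ge2 (model_space m)"
  shows "reducible_on (model_space m) (\<lambda>h. compressed_shift m (compressed_shift m h)) \<longleftrightarrow>
    ((\<forall>z\<in>ball 0 1. m z = m (- z)) \<or>
     (\<exists>\<mu>\<in>ball 0 1. \<exists>p\<in>Hinf. (\<forall>z\<in>ball 0 1. p z = p (- z)) \<and>
        (\<forall>z\<in>ball 0 1. m z = p z * ((z + \<mu>) / (1 + cnj \<mu> * z)))))"
proof -
  interpret inner_model m
    using assms(1) by unfold_locales
  obtain x where "x \<in> model" "x \<noteq> 0" "fps_nth x 0 = 0"
    using dim_ge2_imp_vanishing[OF assms(2)] .
  then show ?thesis
    using exists_reducing_iff unfolding reducible_on_iff even_taylor_iff Blaschke_taylor_iff by blast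
qed

end
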